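(* Let $D\subset\mathbb{R}^2$ be an unbounded simply connected domain with $\partial D\neq\emptyset$, and let $u$ be a solution of the minimal surface equation $$\operatorname{div}\left(\frac{\nabla u}{\sqrt{1+|\nabla u|^2}}\right)=0\quad\text{in } D,$$ with $$u>0\ \text{ in } D,\qquad u=0\ \text{ on } \partial D.$$ Let $M(r)$ denote the maximum value of $u$ on $D\cap\{|z|=r\}$. Then $$\liminf_{r\to\infty}\frac{\log M(r)}{\log r}\geq \frac12 .$$
   Context: The plane $\mathbb{R}^2$ is identified with $\mathbb{C}$ via $z=x+iy$. A domain is a nonempty connected open set. A solution $u$ of the boundary value problem is understood classically: $u$ is $C^2$ in $D$, continuous on $\overline{D}$, and takes the value $0$ at every (finite) boundary point of $D$. Since $D$ is connected and unbounded, $D\cap\{|z|=r\}$ is nonempty for all sufficiently large $r$, so $M(r)$ is defined for all large $r$. *)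

theory Defs
  imports "HOL-Analysis.Analysis"
begin

definition gradient :: "('a::euclidean_space \<Rightarrow> real) \<Rightarrow> 'a \<Rightarrow> 'a" where
  "gradient f z = (\<Sum>b\<in>Basis. frechet_derivative f (at z) b *\<^sub>R b)"

definition divergence :: "('a::euclidean_space \<Rightarrow> 'a) \<Rightarrow> 'a \<Rightarrow> real" where
  "divergence F z = (\<Sum>b\<in>Basis. frechet_derivative F (at z) b \<bullet> b)"

definition C1_on :: "'a::euclidean_space set \<Rightarrow> ('a \<Rightarrow> 'b::real_normed_vector) \<Rightarrow> bool" where
  "C1_on D f \<longleftrightarrow> (\<forall>z\<in>D. f differentiable (at z)) \<and>
     (\<forall>b\<in>Basis. continuous_on D (\<lambda>z. frechet_derivative f (at z) b))"

definition C2_on :: "'a::euclidean_space set \<Rightarrow> ('a \<Rightarrow> real) \<Rightarrow> bool" where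
  "C2_on D f \<longleftrightarrow> C1_on D f \<and> C1_on D (gradient f)"

definition minimal_surface_eq_on :: "'a::euclidean_space set \<Rightarrow> ('a \<Rightarrow> real) \<Rightarrow> bool" where
  "minimal_surface_eq_on D u \<longleftrightarrow>
     (\<forall>z\<in>D. divergence (\<lambda>w. gradient u w /\<^sub>R sqrt (1 + (norm (gradient u w))\<^sup>2)) z = 0)"

(* For u continuous on the closure of D, positive on D and zero on the frontier, the
   maximum is attained whenever D meets the circle; otherwise the value is unspecified. *)
definition circle_max :: "complex set \<Rightarrow> (complex \<Rightarrow> real) \<Rightarrow> real \<Rightarrow> real" where
  "circle_max D u r = (GREATEST m. m \<in> u ` (D \<inter> {z. cmod z = r}))"

lemma GDERIV_gradient:
  assumes "f differentiable (at z)"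
  shows "GDERIV f z :> gradient f z"
proof -
  let ?A = "frechet_derivative f (at z)"
  have d: "(f has_derivative ?A) (at z)"
    using assms by (simp add: frechet_derivative_works)
  then interpret bounded_linear ?A
    by (rule has_derivative_bounded_linear)
  have "?A h = h \<bullet> gradient f z" for h
  proof -
    have "?A h = ?A (\<Sum>b\<in>Basis. (h \<bullet> b) *\<^sub>R b)"
      by (simp add: euclidean_representation)
    also have "\<dots> = h \<bullet> gradient f z"
      by (simp add: sum scaleR gradient_def inner_sum_right mult.commute)
    finally show ?thesis .
  qed
  then have "?A = (\<lambda>h. h \<bullet> gradient f z)" by blast
  with d show ?thesis by (simp add: gderiv_def)
qed

end

theory Submission
  imports Defs "HOL-Complex_Analysis.Cauchy_Integral_Formula"
begin

text \<open>
  In logarithmic coordinates \<open>z = exp (s + \<i> t)\<close> the function \<open>u\<close>, extended by 0, becomes \<open>v\<close>, periodic in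
  \<open>t\<close>, with \<open>p = v_s\<close>, \<open>q = v_t\<close>, \<open>W = sqrt (1 + exp (-2 s) (p^2 + q^2))\<close>, and the equation reads
  \<open>(p / W)_s + (q / W)_t = 0\<close>. Away from the zero set of \<open>u\<close> (made precise by cutting off at a small
  positive height) the flux \<open>A(s)\<close>, the integral of \<open>v p / W\<close> over a period, has as derivative
  the energy \<open>A'(s)\<close>, the integral of \<open>(p^2 + q^2) / W\<close>. As \<open>D\<close> is simply connected, \<open>v\<close> vanishes
  somewhere on each large circle, so Wirtinger's inequality with respect to the measure \<open>W dt\<close> gives
  \<open>2 pi A \<le> \<Lambda> A'\<close>, where \<open>\<Lambda>\<close> is the integral of \<open>W\<close> over a period. Since \<open>W \<le> 1 + (p^2 + q^2) exp (-2 s) / W\<close>,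
  \<open>\<Lambda> \<le> 2 pi + exp (-2 s) A'\<close> up to lower order terms, hence \<open>(ln A)' \<ge> 1 - exp (-2 s) A' / (2 pi)\<close>.
  The error term has bounded integral over any interval on which \<open>A \<le> exp s\<close>; starting from the last point
  where \<open>A \<ge> exp s\<close>, one gets \<open>A \<ge> c exp s\<close>. Finally \<open>A^2 \<le> 2 pi M^2 A'\<close> by Cauchy--Schwarz, and with the
  maximum principle this integrates to \<open>A(s - 1) \<le> 2 pi M(exp s)^2\<close>, so \<open>M(r) \<ge> c sqrt r\<close>.
\<close>

subsection \<open>Weighted Wirtinger inequality and cutoff functions\<close>

text \<open>The integral over a moving period is differentiated in its starting point: the
  derivative \<open>f (x + L) - f x\<close> vanishes. Later the period can thus be started at a zero
  of \<open>v\<close>.\<close>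

lemma integral_shift_period:
  fixes f :: "real \<Rightarrow> real"
  assumes cont: "continuous_on UNIV f" and L: "0 \<le> L" and per: "\<And>t. f (t + L) = f t"
  shows "integral {a..a + L} f = integral {0..L} f"
proof -
  define lo hi where "lo = min 0 a - 1" and "hi = max 0 a + L + 1"
  obtain F where F: "\<And>x. x \<in> {lo..hi} \<Longrightarrow> (F has_vector_derivative f x) (at x within {lo..hi})"
    using antiderivative_continuous[OF continuous_on_subset[OF cont subset_UNIV]] by metis
  have F': "(F has_real_derivative f x) (at x)" if "lo < x" "x < hi" for x
    using F[of x] that at_within_Icc_at[of lo x hi]
    by (simp add: has_real_derivative_iff_has_vector_derivative)
  have FTC: "integral {x..x + L} f = F (x + L) - F x" if "x \<in> {min 0 a..max 0 a}" for x
  proof (rule integral_unique, rule fundamental_theorem_of_calculus)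
    show "(F has_vector_derivative f y) (at y within {x..x + L})" if "y \<in> {x..x + L}" for y
      using F[of y] that \<open>x \<in> _\<close> by (auto simp: lo_def hi_def intro: has_vector_derivative_within_subset)
  qed (use L in simp)
  have "((\<lambda>x. F (x + L) - F x) has_real_derivative 0) (at x within {min 0 a..max 0 a})"
    if "x \<in> {min 0 a..max 0 a}" for x
  proof -
    have "((\<lambda>x. F (x + L)) has_real_derivative f (x + L)) (at x)"
      using F'[of "x + L"] that L by (auto simp: lo_def hi_def DERIV_shift)
    moreover have "(F has_real_derivative f x) (at x)"
      using F'[of x] that L by (auto simp: lo_def hi_def)
    ultimately have "((\<lambda>x. F (x + L) - F x) has_real_derivative f (x + L) - f x) (at x)"
      by (rule DERIV_diff)
    then show ?thesis
      using per[of x] by (auto intro: has_field_derivative_at_within)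
  qed
  then obtain c where "\<And>x. x \<in> {min 0 a..max 0 a} \<Longrightarrow> F (x + L) - F x = c"
    using has_field_derivative_zero_constant[of "{min 0 a..max 0 a}" "\<lambda>x. F (x + L) - F x"] by auto
  from this[of a] this[of 0] show ?thesis
    using FTC[of a] FTC[of 0] by simp
qed

text \<open>In the variable \<open>T\<close> with \<open>dT = w dt\<close> this is the Dirichlet
  form of Wirtinger's inequality on an interval whose length is the integral of \<open>w\<close>,
  which explains the constant. The argument completes a square instead of changing
  variables.\<close>

lemma weighted_wirtinger:
  fixes f f' w :: "real \<Rightarrow> real"
  assumes ab: "a < b"
    and f: "\<And>t. t \<in> {a..b} \<Longrightarrow> (f has_real_derivative f' t) (at t)"
    and f'_cont: "continuous_on {a..b} f'"
    and w_cont: "continuous_on {a..b} w" and w_pos: "\<And>t. t \<in> {a..b} \<Longrightarrow> 0 < w t"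
    and fa: "f a = 0" and fb: "f b = 0"
  shows "integral {a..b} (\<lambda>t. (f t)\<^sup>2 * w t)
    \<le> (integral {a..b} w / pi)\<^sup>2 * integral {a..b} (\<lambda>t. (f' t)\<^sup>2 / w t)"
proof -
  define \<Lambda> where "\<Lambda> = integral {a..b} w"
  define I where "I = integral {a..b} (\<lambda>t. (f t)\<^sup>2 * w t)"
  define J where "J = integral {a..b} (\<lambda>t. (f' t)\<^sup>2 / w t)"
  have f_cont: "continuous_on {a..b} f"
    using f by (meson DERIV_isCont continuous_at_imp_continuous_on)
  have w_int: "w integrable_on {x..y}" if "a \<le> x" "y \<le> b" for x y
    using w_cont that by (intro integrable_continuous_real) (auto intro: continuous_on_subset)
  have "\<Lambda> \<ge> 0"
    unfolding \<Lambda>_def by (rule integral_nonneg) (use w_int[of a b] w_pos in \<open>auto intro: less_imp_le\<close>)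
  have main: "I \<le> ((\<Lambda> + 2 * \<eta>) / pi)\<^sup>2 * J" if \<eta>: "\<eta> > 0" for \<eta>
  proof -
    define c where "c = pi / (\<Lambda> + 2 * \<eta>)"
    define T where "T = (\<lambda>t. \<eta> + integral {a..t} w)"
    have c: "c > 0" using \<open>\<Lambda> \<ge> 0\<close> \<eta> by (simp add: c_def)
    have T_deriv: "(T has_real_derivative w t) (at t within {a..b})" if "t \<in> {a..b}" for t
      unfolding T_def using integral_has_real_derivative[OF w_cont that]
      by (auto intro!: derivative_eq_intros)
    have T_bounds: "0 < c * T t \<and> c * T t < pi" if t: "t \<in> {a..b}" for t
    proof -
      have 1: "0 \<le> integral {a..t} w" "0 \<le> integral {t..b} w"
        using w_int w_pos t by (auto intro!: integral_nonneg simp: less_imp_le)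
      have 2: "integral {a..t} w + integral {t..b} w = \<Lambda>"
        unfolding \<Lambda>_def
        by (rule Henstock_Kurzweil_Integration.integral_combine) (use t w_int in auto)
      have "0 < T t" "T t < \<Lambda> + 2 * \<eta>" using 1 2 \<eta> by (auto simp: T_def)
      moreover have "c * (\<Lambda> + 2 * \<eta>) = pi" using \<open>\<Lambda> \<ge> 0\<close> \<eta> by (simp add: c_def)
      ultimately show ?thesis using c by (metis mult_pos_pos mult_strict_left_mono)
    qed
    \<comment> \<open>\<open>c cot (c T) f^2\<close> vanishes at both ends, and its derivative is \<open>f'^2 / w - c^2 f^2 w\<close> minus a square
      over \<open>w\<close>; the shift \<open>\<eta>\<close> keeps \<open>c T\<close> off the poles of the cotangent.\<close>
    define ct where "ct = (\<lambda>t. cos (c * T t) / sin (c * T t))"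
    define \<phi>' where "\<phi>' = (\<lambda>t. - c\<^sup>2 * w t * (1 + (ct t)\<^sup>2) * (f t)\<^sup>2 + 2 * c * ct t * f t * f' t)"
    have sin: "sin (c * T t) > 0" if "t \<in> {a..b}" for t
      using T_bounds[OF that] by (intro sin_gt_zero) auto
    have ct: "(ct has_real_derivative - c * w t * (1 + (ct t)\<^sup>2)) (at t within {a..b})"
      if "t \<in> {a..b}" for t
    proof -
      let ?x = "c * T t"
      have "(ct has_real_derivative
          (- sin ?x * (c * w t) * sin ?x - cos ?x * (cos ?x * (c * w t))) / (sin ?x * sin ?x))
          (at t within {a..b})"
        unfolding ct_def
        by (rule derivative_eq_intros T_deriv that refl)+ (use sin[OF that] in auto)
      also have "- sin ?x * (c * w t) * sin ?x - cos ?x * (cos ?x * (c * w t))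
          = - c * w t * ((sin ?x)\<^sup>2 + (cos ?x)\<^sup>2)"
        by algebra
      also have "- c * w t * ((sin ?x)\<^sup>2 + (cos ?x)\<^sup>2) / (sin ?x * sin ?x)
          = - c * w t * (1 + (ct t)\<^sup>2)"
      proof -
        have "1 + (ct t)\<^sup>2 = ((sin ?x)\<^sup>2 + (cos ?x)\<^sup>2) / (sin ?x * sin ?x)"
          using sin[OF that]
          by (simp add: ct_def power2_eq_square add_divide_distrib del: sin_cos_squared_add3)
        then show ?thesis by simp
      qed
      finally show ?thesis .
    qed
    have "((\<lambda>t. c * ct t * (f t)\<^sup>2) has_real_derivative \<phi>' t) (at t within {a..b})"
      if "t \<in> {a..b}" for t
      by (rule derivative_eq_intros ct[OF that] has_field_derivative_at_within[OF f[OF that]] refl)+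
         (auto simp: \<phi>'_def field_simps power2_eq_square)
    then have "(\<phi>' has_integral c * ct b * (f b)\<^sup>2 - c * ct a * (f a)\<^sup>2) {a..b}"
      using ab by (intro fundamental_theorem_of_calculus)
        (auto simp: has_real_derivative_iff_has_vector_derivative)
    then have int0: "(\<phi>' has_integral 0) {a..b}"
      by (simp add: fa fb)
    have "continuous_on {a..b} (\<lambda>t. (f' t)\<^sup>2 / w t)" "continuous_on {a..b} (\<lambda>t. (f t)\<^sup>2 * w t)"
      using w_pos by (intro continuous_intros f'_cont f_cont w_cont ballI; force)+
    then have "((\<lambda>t. (f' t)\<^sup>2 / w t) has_integral J) {a..b}"
      and "((\<lambda>t. (f t)\<^sup>2 * w t) has_integral I) {a..b}"
      unfolding I_def J_def by (simp_all add: integrable_continuous_real integrable_integral)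
    then have int1: "((\<lambda>t. (f' t)\<^sup>2 / w t - c\<^sup>2 * ((f t)\<^sup>2 * w t)) has_integral J - c\<^sup>2 * I) {a..b}"
      by (intro has_integral_diff has_integral_mult_right)
    have "\<phi>' t \<le> (f' t)\<^sup>2 / w t - c\<^sup>2 * ((f t)\<^sup>2 * w t)" if "t \<in> {a..b}" for t
    proof -
      have "0 \<le> (f' t - c * w t * ct t * f t)\<^sup>2 / w t"
        using w_pos[OF that] by simp
      also have "\<dots> = (f' t)\<^sup>2 / w t - c\<^sup>2 * ((f t)\<^sup>2 * w t) - \<phi>' t"
        using w_pos[OF that] by (simp add: \<phi>'_def field_simps power2_eq_square)
      finally show ?thesis by simp
    qed
    then have "0 \<le> J - c\<^sup>2 * I"
      by (rule has_integral_le[OF int0 int1])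
    then have "((\<Lambda> + 2 * \<eta>) / pi)\<^sup>2 * (c\<^sup>2 * I) \<le> ((\<Lambda> + 2 * \<eta>) / pi)\<^sup>2 * J"
      by (intro mult_left_mono) auto
    moreover have "((\<Lambda> + 2 * \<eta>) / pi) * c = 1"
      using \<open>\<Lambda> \<ge> 0\<close> \<eta> by (simp add: c_def)
    then have "((\<Lambda> + 2 * \<eta>) / pi)\<^sup>2 * c\<^sup>2 = 1"
      by (metis power_mult_distrib power_one)
    then have "((\<Lambda> + 2 * \<eta>) / pi)\<^sup>2 * (c\<^sup>2 * I) = I"
      by (metis mult.assoc mult_1)
    ultimately show ?thesis by linarith
  qed
  have "((\<lambda>\<eta>. ((\<Lambda> + 2 * \<eta>) / pi)\<^sup>2 * J) \<longlongrightarrow> ((\<Lambda> + 2 * 0) / pi)\<^sup>2 * J) (at_right 0)"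
    by (intro tendsto_intros) auto
  moreover have "eventually (\<lambda>\<eta>. I \<le> ((\<Lambda> + 2 * \<eta>) / pi)\<^sup>2 * J) (at_right 0)"
    using main by (auto simp: eventually_at_right_less eventually_mono intro: eventually_at_right_less[THEN eventually_mono])
  ultimately have "I \<le> ((\<Lambda> + 2 * 0) / pi)\<^sup>2 * J"
    by (rule tendsto_lowerbound) simp
  then show ?thesis by (simp add: I_def J_def \<Lambda>_def)
qed

text \<open>Composed with \<open>v\<close>, both functions vanish in a neighbourhood of the zero set
  of \<open>v\<close>. Products with quantities that are regular only where \<open>v > 0\<close>
  thereby become regular everywhere.\<close>

definition cutoff :: "real \<Rightarrow> (real \<Rightarrow> real) \<Rightarrow> (real \<Rightarrow> real) \<Rightarrow> bool" where
  "cutoff \<epsilon> g G \<longleftrightarrow> 0 < \<epsilon> \<and> continuous_on UNIV g \<and> (\<forall>t\<le>\<epsilon>. g t = 0 \<and> G t = 0) \<and>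
     (\<forall>t. (G has_real_derivative g t) (at t))"

lemma cutoff_exists:
  assumes \<epsilon>: "0 < \<epsilon>" and cont: "continuous_on UNIV g" and g: "\<And>t. t \<le> \<epsilon> \<Longrightarrow> g t = 0"
  obtains G where "cutoff \<epsilon> g G"
proof
  \<comment> \<open>For negative \<open>x\<close> the interval \<open>{0..x}\<close> is empty and
    the integral is 0, which is the right value since \<open>g\<close> vanishes there.\<close>
  let ?G = "\<lambda>x. integral {0..x} g"
  have zero: "?G t = 0" if "t \<le> \<epsilon>" for t
    by (rule integral_unique, rule has_integral_is_0) (use g that in auto)
  have "(?G has_real_derivative g t) (at t)" for t
  proof (cases "t < \<epsilon>")
    case True
    have "eventually (\<lambda>x. x < \<epsilon>) (nhds t)"
      using True by (intro order_tendstoD(2)[OF filterlim_ident]) 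
    then have "eventually (\<lambda>x. ?G x = 0) (nhds t)"
      by eventually_elim (use zero in auto)
    moreover have "((\<lambda>x. 0::real) has_real_derivative g t) (at t)"
      using g[of t] True by simp
    ultimately show ?thesis
      by (subst DERIV_cong_ev[OF refl _ refl]) 
  next
    case False
    have "(?G has_real_derivative g t) (at t within {0..t + 1})"
      using False \<epsilon> by (intro integral_has_real_derivative continuous_on_subset[OF cont]) auto
    then show ?thesis
      using False \<epsilon> at_within_Icc_at[of 0 t "t + 1"] by simp
  qed
  then show "cutoff \<epsilon> g ?G"
    using assms zero by (simp add: cutoff_def)
qed

lemma cutoff_mono:
  assumes "cutoff \<epsilon> g G" and "\<And>t. 0 \<le> g t" and "x \<le> y"
  shows "G x \<le> G y"
  using assms by (intro DERIV_nonneg_imp_nondecreasing[of x y G]) (auto simp: cutoff_def)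

lemma cutoff_nonneg:
  assumes "cutoff \<epsilon> g G" and "\<And>t. 0 \<le> g t"
  shows "0 \<le> G x"
  using cutoff_mono[OF assms, of "min x \<epsilon>" x] assms(1) by (auto simp: cutoff_def)

lemma cutoff_pos:
  assumes c: "cutoff \<epsilon> g G" and nn: "\<And>t. 0 \<le> g t" and pos: "\<And>t. \<mu> < t \<Longrightarrow> 0 < g t" and x: "\<mu> < x"
  shows "0 < G x"
proof -
  have "G \<mu> < G x"
    by (rule DERIV_pos_imp_increasing_open[OF x])
       (use c pos in \<open>auto simp: cutoff_def intro!: DERIV_continuous_on intro: has_field_derivative_at_within\<close>)
  then show ?thesis using cutoff_nonneg[OF c nn, of \<mu>] by simp
qed

subsection \<open>Minimal graphs in logarithmic coordinates\<close>

text \<open>This is \<open>sqrt (1 + |grad u|^2)\<close>: the coordinate change is conformal with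
  factor \<open>exp s\<close>, so \<open>|grad u|^2\<close> becomes
  \<open>exp (- 2 * s) * (p^2 + q^2)\<close>.\<close>

definition area_density :: "(real \<Rightarrow> real \<Rightarrow> real) \<Rightarrow> (real \<Rightarrow> real \<Rightarrow> real) \<Rightarrow> real \<Rightarrow> real \<Rightarrow> real" where
  "area_density p q s t = sqrt (1 + exp (- 2 * s) * ((p s t)\<^sup>2 + (q s t)\<^sup>2))"

lemma has_real_derivative_zero_if_locally_zero:
  fixes f u :: "real \<Rightarrow> real"
  assumes "isCont u x" and "u x < \<epsilon>" and "\<And>y. u y < \<epsilon> \<Longrightarrow> f y = 0"
  shows "(f has_real_derivative 0) (at x)"
proof -
  have "eventually (\<lambda>y. u y < \<epsilon>) (nhds x)"
    using assms(1,2) by (simp add: continuous_within tendsto_at_iff_tendsto_nhds order_tendstoD(2))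
  then have "eventually (\<lambda>y. f y = 0) (nhds x)"
    by eventually_elim (rule assms(3))
  then show ?thesis
    by (subst DERIV_cong_ev[OF refl _ refl]) auto
qed

text \<open>An axiomatic form of \<open>u\<close>, extended by 0 and composed with
  \<open>exp\<close>. Derivatives are demanded only where \<open>v\<close> is positive. The bound
  for \<open>s \<le> 0\<close> records that \<open>u\<close> is bounded near the origin; it serves
  as boundary condition at \<open>s = -infinity\<close>.\<close>

locale log_minimal_graph =
  fixes v p q P' :: "real \<Rightarrow> real \<Rightarrow> real"
  assumes v_cont: "continuous_on UNIV (\<lambda>(s, t). v s t)"
    and v_nonneg: "0 \<le> v s t"
    and v_per: "v s (t + 2 * pi) = v s t"
    and p_per: "p s (t + 2 * pi) = p s t"
    and q_per: "q s (t + 2 * pi) = q s t"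
    and v_s: "0 < v s t \<Longrightarrow> ((\<lambda>s. v s t) has_real_derivative p s t) (at s)"
    and v_t: "0 < v s t \<Longrightarrow> ((\<lambda>t. v s t) has_real_derivative q s t) (at t)"
    and p_cont: "continuous_on {(s, t). 0 < v s t} (\<lambda>(s, t). p s t)"
    and q_cont: "continuous_on {(s, t). 0 < v s t} (\<lambda>(s, t). q s t)"
    \<comment> \<open>\<open>P'\<close> is the \<open>s\<close>-derivative of \<open>p / W\<close>; the sign in \<open>Q_t\<close> below is the minimal surface equation.\<close>
    and P'_cont: "continuous_on {(s, t). 0 < v s t} (\<lambda>(s, t). P' s t)"
    and P_s: "0 < v s t \<Longrightarrow> ((\<lambda>s. p s t / area_density p q s t) has_real_derivative P' s t) (at s)"
    and Q_t: "0 < v s t \<Longrightarrow> ((\<lambda>t. q s t / area_density p q s t) has_real_derivative - P' s t) (at t)"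
    and v_bdd: "\<exists>K. \<forall>s\<le>0. \<forall>t. v s t \<le> K"
begin

abbreviation W where "W \<equiv> area_density p q"

definition P where "P s t = p s t / W s t"

definition edens where "edens s t = ((p s t)\<^sup>2 + (q s t)\<^sup>2) / W s t"

text \<open>In the plane this is the flux of \<open>G u * grad u / sqrt (1 + |grad u|^2)\<close>
  through the circle of radius \<open>exp s\<close>.\<close>

definition flux where "flux G s = integral {0..2 * pi} (\<lambda>t. G (v s t) * P s t)"

definition energy where "energy g s = integral {0..2 * pi} (\<lambda>t. g (v s t) * edens s t)"

section \<open>Elementary bounds, regularity after cutting off, and the derivative of the
  flux\<close>

lemma W_ge_1: "1 \<le> W s t"
  by (simp add: area_density_def)

lemma W_pos [simp]: "0 < W s t"
  using W_ge_1[of s t] by linarith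

lemma W_nonzero [simp]: "W s t \<noteq> 0"
  using W_pos[of s t] by linarith

lemma abs_W [simp]: "\<bar>W s t\<bar> = W s t"
  using W_pos[of s t] by linarith

lemma W_per: "W s (t + 2 * pi) = W s t"
  by (simp add: area_density_def p_per q_per)

lemma P_per: "P s (t + 2 * pi) = P s t"
  by (simp add: P_def W_per p_per)

lemma edens_per: "edens s (t + 2 * pi) = edens s t"
  by (simp add: edens_def W_per p_per q_per)

lemma edens_nonneg: "0 \<le> edens s t"
  by (simp add: edens_def less_imp_le)

text \<open>In the plane: \<open>grad u / W\<close> has length at most 1, and \<open>p\<close> is
  \<open>exp s\<close> times the radial derivative of \<open>u\<close>.\<close>

lemma abs_P_le: "\<bar>P s t\<bar> \<le> exp s"
proof -
  have "(exp (- s) * \<bar>p s t\<bar>)\<^sup>2 \<le> 1 + exp (- 2 * s) * ((p s t)\<^sup>2 + (q s t)\<^sup>2)"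
    by (simp add: power_mult_distrib algebra_simps flip: exp_double)
  then have "exp (- s) * \<bar>p s t\<bar> \<le> W s t"
    unfolding area_density_def by (rule real_le_rsqrt)
  then show ?thesis
    by (simp add: P_def exp_minus field_simps)
qed

lemma W_cont: "continuous_on {(s, t). 0 < v s t} (\<lambda>(s, t). W s t)"
  using p_cont q_cont unfolding area_density_def case_prod_beta
  by (intro continuous_intros) auto

lemma P_cont: "continuous_on {(s, t). 0 < v s t} (\<lambda>(s, t). P s t)"
  using p_cont W_cont unfolding P_def case_prod_beta
  by (intro continuous_intros) auto

lemma edens_cont: "continuous_on {(s, t). 0 < v s t} (\<lambda>(s, t). edens s t)"
  using p_cont q_cont W_cont unfolding edens_def case_prod_beta
  by (intro continuous_intros) auto

text \<open>The open sets \<open>v > 0\<close> and \<open>v < \<epsilon>\<close> cover the plane,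
  and on the second one the product is 0.\<close>

lemma cutoff_cont:
  fixes F :: "real \<Rightarrow> real \<Rightarrow> real"
  assumes "0 < \<epsilon>" and "continuous_on UNIV g" and "\<And>t. t \<le> \<epsilon> \<Longrightarrow> g t = 0"
    and F: "continuous_on {(s, t). 0 < v s t} (\<lambda>(s, t). F s t)"
  shows "continuous_on UNIV (\<lambda>(s, t). g (v s t) * F s t)"
proof -
  have gv: "continuous_on A (\<lambda>(s, t). g (v s t))" for A
    using continuous_on_compose2[OF assms(2) v_cont] continuous_on_subset
    by (force simp: case_prod_beta)
  have op: "open {(s, t). 0 < v s t}" "open {(s, t). v s t < \<epsilon>}"
    using open_Collect_less[OF continuous_on_const v_cont, of 0]
      open_Collect_less[OF v_cont continuous_on_const, of \<epsilon>]
    by (simp_all add: case_prod_unfold)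
  have "continuous_on ({(s, t). 0 < v s t} \<union> {(s, t). v s t < \<epsilon>}) (\<lambda>(s, t). g (v s t) * F s t)"
  proof (rule continuous_on_open_Un[OF op])
    show "continuous_on {(s, t). 0 < v s t} (\<lambda>(s, t). g (v s t) * F s t)"
      using continuous_on_mult[OF gv[unfolded case_prod_unfold] F[unfolded case_prod_unfold]]
      by (simp add: case_prod_unfold)
    have "continuous_on {(s, t). v s t < \<epsilon>} (\<lambda>_. 0 :: real)" by simp
    then show "continuous_on {(s, t). v s t < \<epsilon>} (\<lambda>(s, t). g (v s t) * F s t)"
      by (rule continuous_on_eq) (auto simp: assms(3))
  qed
  moreover have "{(s, t). 0 < v s t} \<union> {(s, t). v s t < \<epsilon>} = UNIV"
    using assms(1) by force
  ultimately show ?thesis by simp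
qed

lemma slice: "continuous_on UNIV (\<lambda>(s, t). F s t) \<Longrightarrow> continuous_on A (F s)"
  for F :: "real \<Rightarrow> real \<Rightarrow> real"
  by (rule continuous_on_compose2[where g = "\<lambda>(s, t). F s t" and f = "Pair s", simplified])
    (auto intro!: continuous_intros)

lemma slice': "continuous_on UNIV (\<lambda>(s, t). F s t) \<Longrightarrow> continuous_on A (\<lambda>s. F s t)"
  for F :: "real \<Rightarrow> real \<Rightarrow> real"
  by (rule continuous_on_compose2[where g = "\<lambda>(s, t). F s t" and f = "\<lambda>s. (s, t)", simplified])
    (auto intro!: continuous_intros)

lemma v_isCont: "isCont (v s) t" "isCont (\<lambda>s. v s t) s"
  using slice[OF v_cont, of UNIV] slice'[OF v_cont, of UNIV]
  by (simp_all add: continuous_on_eq_continuous_at)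

text \<open>Where \<open>v > 0\<close> these are the chain and product rules; at a zero of
  \<open>v\<close> every function involved vanishes nearby. The minimal surface equation enters
  through the opposite signs of the two \<open>P'\<close> terms.\<close>

lemma cutoff_deriv:
  assumes c: "cutoff \<epsilon> g G"
  shows "((\<lambda>s. G (v s t)) has_real_derivative g (v s t) * p s t) (at s)"
    and "((\<lambda>t. G (v s t)) has_real_derivative g (v s t) * q s t) (at t)"
    and "((\<lambda>s. G (v s t) * P s t) has_real_derivative
            g (v s t) * p s t * P s t + G (v s t) * P' s t) (at s)"
    and "((\<lambda>t. G (v s t) * (q s t / W s t)) has_real_derivative
            g (v s t) * q s t * (q s t / W s t) - G (v s t) * P' s t) (at t)"
proof -
  have \<epsilon>: "0 < \<epsilon>" and zero: "\<And>x. x \<le> \<epsilon> \<Longrightarrow> g x = 0 \<and> G x = 0"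
    and G: "\<And>x. (G has_real_derivative g x) (at x)"
    using c by (auto simp: cutoff_def)
  have *: "((\<lambda>s. G (v s t)) has_real_derivative g (v s t) * p s t) (at s) \<and>
     ((\<lambda>t. G (v s t)) has_real_derivative g (v s t) * q s t) (at t) \<and>
     ((\<lambda>s. G (v s t) * P s t) has_real_derivative
            g (v s t) * p s t * P s t + G (v s t) * P' s t) (at s) \<and>
     ((\<lambda>t. G (v s t) * (q s t / W s t)) has_real_derivative
            g (v s t) * q s t * (q s t / W s t) - G (v s t) * P' s t) (at t)"
  proof (cases "0 < v s t")
    case True
    note 1 = DERIV_chain2[OF G v_s[OF True]] and 2 = DERIV_chain2[OF G v_t[OF True]]
    show ?thesis
      using 1 2 DERIV_mult[OF 1 P_s[OF True]] DERIV_mult[OF 2 Q_t[OF True]]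
      by (simp add: P_def algebra_simps)
  next
    case False
    then have "v s t = 0" using v_nonneg[of s t] by simp
    with \<epsilon> have less: "v s t < \<epsilon>" and 0: "g (v s t) = 0" "G (v s t) = 0"
      using zero[of 0] by auto
    note has_real_derivative_zero_if_locally_zero[OF v_isCont(1) less]
      has_real_derivative_zero_if_locally_zero[OF v_isCont(2) less]
    then show ?thesis
      unfolding 0 using zero by simp
  qed
  then show "((\<lambda>s. G (v s t)) has_real_derivative g (v s t) * p s t) (at s)"
    and "((\<lambda>t. G (v s t)) has_real_derivative g (v s t) * q s t) (at t)"
    and "((\<lambda>s. G (v s t) * P s t) has_real_derivative
            g (v s t) * p s t * P s t + G (v s t) * P' s t) (at s)"
    and "((\<lambda>t. G (v s t) * (q s t / W s t)) has_real_derivative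
            g (v s t) * q s t * (q s t / W s t) - G (v s t) * P' s t) (at t)"
    by auto
qed

lemma cutoff_conts:
  assumes c: "cutoff \<epsilon> g G"
  shows "continuous_on UNIV (\<lambda>(s, t). g (v s t) * edens s t)"
    and "continuous_on UNIV (\<lambda>(s, t). G (v s t) * P s t)"
    and "continuous_on UNIV (\<lambda>(s, t). G (v s t) * P' s t)"
    and "continuous_on UNIV (\<lambda>(s, t). g (v s t) * p s t)"
    and "continuous_on UNIV (\<lambda>(s, t). g (v s t) * q s t)"
    and "continuous_on UNIV (\<lambda>(s, t). G (v s t))"
proof -
  have G: "continuous_on UNIV G"
    using c by (auto simp: cutoff_def intro!: DERIV_continuous_on)
  show "continuous_on UNIV (\<lambda>(s, t). g (v s t) * edens s t)"
    using c by (intro cutoff_cont[of \<epsilon>] edens_cont) (auto simp: cutoff_def)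
  show "continuous_on UNIV (\<lambda>(s, t). G (v s t) * P s t)"
    using c by (intro cutoff_cont[of \<epsilon>] P_cont G) (auto simp: cutoff_def)
  show "continuous_on UNIV (\<lambda>(s, t). G (v s t) * P' s t)"
    using c by (intro cutoff_cont[of \<epsilon>] P'_cont G) (auto simp: cutoff_def)
  show "continuous_on UNIV (\<lambda>(s, t). g (v s t) * p s t)"
    using c by (intro cutoff_cont[of \<epsilon>] p_cont) (auto simp: cutoff_def)
  show "continuous_on UNIV (\<lambda>(s, t). g (v s t) * q s t)"
    using c by (intro cutoff_cont[of \<epsilon>] q_cont) (auto simp: cutoff_def)
  show "continuous_on UNIV (\<lambda>(s, t). G (v s t))"
    using continuous_on_compose2[OF G v_cont] by (simp add: case_prod_beta)
qed

text \<open>The divergence theorem: after differentiation under the integral sign, the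
  \<open>t\<close>-derivative \<open>?Y'\<close> of the periodic function \<open>?Y\<close> is
  added. It integrates to 0 over a period and cancels the \<open>P'\<close> term, leaving the energy
  density.\<close>

lemma flux_deriv:
  assumes c: "cutoff \<epsilon> g G"
  shows "(flux G has_real_derivative energy g s) (at s)"
proof -
  let ?fx = "\<lambda>s t. g (v s t) * p s t * P s t + G (v s t) * P' s t"
  let ?Y = "\<lambda>t. G (v s t) * (q s t / W s t)"
  let ?Y' = "\<lambda>t. g (v s t) * q s t * (q s t / W s t) - G (v s t) * P' s t"
  have "continuous_on UNIV (\<lambda>(s, t). g (v s t) * (p s t * P s t))"
    using c p_cont P_cont
    by (intro cutoff_cont[of \<epsilon>]) (auto simp: cutoff_def case_prod_beta intro!: continuous_intros)
  with cutoff_conts(3)[OF c] have fx_cont: "continuous_on UNIV (\<lambda>(s, t). ?fx s t)"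
    by (auto simp: case_prod_beta mult.assoc intro!: continuous_intros)
  have "((\<lambda>s. integral (cbox 0 (2 * pi)) (\<lambda>t. G (v s t) * P s t)) has_field_derivative
      integral (cbox 0 (2 * pi)) (?fx s)) (at s within UNIV)"
  proof (rule leibniz_rule_field_derivative)
    show "(\<lambda>t. G (v x t) * P x t) integrable_on cbox 0 (2 * pi)" for x
      using slice[OF cutoff_conts(2)[OF c]] by (auto intro: integrable_continuous_real)
    show "continuous_on (UNIV \<times> cbox 0 (2 * pi)) (\<lambda>(s, t). ?fx s t)"
      by (rule continuous_on_subset[OF fx_cont]) auto
  qed (use cutoff_deriv(3)[OF c] in auto)
  moreover have "integral {0..2 * pi} (?fx s) = energy g s"
  proof -
    have "(?Y' has_integral ?Y (2 * pi) - ?Y 0) {0..2 * pi}"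
      by (intro fundamental_theorem_of_calculus)
        (use cutoff_deriv(4)[OF c, of s] in
          \<open>auto simp: has_real_derivative_iff_has_vector_derivative intro: has_vector_derivative_at_within\<close>)
    moreover have "?Y (2 * pi) = ?Y 0"
      using v_per[of s 0] q_per[of s 0] W_per[of s 0] by simp
    ultimately have "(?Y' has_integral 0) {0..2 * pi}" by simp
    moreover have "(?fx s has_integral integral {0..2 * pi} (?fx s)) {0..2 * pi}"
      using slice[OF fx_cont] by (intro integrable_integral integrable_continuous_real)
    ultimately have "((\<lambda>t. ?fx s t + ?Y' t) has_integral integral {0..2 * pi} (?fx s) + 0) {0..2 * pi}"
      by (intro has_integral_add)
    moreover have "?fx s t + ?Y' t = g (v s t) * edens s t" for t
      by (simp add: P_def edens_def power2_eq_square algebra_simps add_divide_distrib)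
    ultimately show ?thesis
      unfolding energy_def by (metis (no_types, lifting) add.right_neutral integral_unique ext)
  qed
  ultimately show ?thesis
    unfolding flux_def[abs_def] by simp
qed

section \<open>Sign and monotonicity of the flux, and the maximum principle\<close>

lemma energy_nonneg: "cutoff \<epsilon> g G \<Longrightarrow> (\<And>t. 0 \<le> g t) \<Longrightarrow> 0 \<le> energy g s"
  unfolding energy_def using slice[OF cutoff_conts(1)]
  by (intro integral_nonneg integrable_continuous_real) (auto simp: edens_nonneg)

lemma abs_flux_le:
  assumes c: "cutoff \<epsilon> g G" and K: "\<And>t. \<bar>G (v s t)\<bar> \<le> K"
  shows "\<bar>flux G s\<bar> \<le> 2 * pi * K * exp s"
proof -
  have "norm (integral {0..2 * pi} (\<lambda>t. G (v s t) * P s t)) \<le> K * exp s * (2 * pi - 0)"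
  proof (rule integral_bound)
    show "norm (G (v s t) * P s t) \<le> K * exp s" for t
      using mult_mono[OF K abs_P_le] order_trans[OF abs_ge_zero K] by (auto simp: abs_mult)
  qed (use slice[OF cutoff_conts(2)[OF c]] in auto)
  then show ?thesis by (simp add: flux_def algebra_simps)
qed

lemma flux_mono:
  assumes c: "cutoff \<epsilon> g G" and nn: "\<And>t. 0 \<le> g t" and "s \<le> s'"
  shows "flux G s \<le> flux G s'"
  using flux_deriv[OF c] energy_nonneg[OF c nn] assms(3)
  by (intro DERIV_nonneg_imp_nondecreasing[of s s' "flux G"]) auto

text \<open>The flux is nondecreasing, and it is \<open>O(exp s)\<close> at \<open>-infinity\<close>
  because \<open>v\<close> is bounded for \<open>s \<le> 0\<close>; so its limit there is 0.\<close>

lemma flux_nonneg: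
  assumes c: "cutoff \<epsilon> g G" and nn: "\<And>t. 0 \<le> g t"
  shows "0 \<le> flux G s"
proof -
  obtain K where K: "\<And>s t. s \<le> 0 \<Longrightarrow> v s t \<le> K" using v_bdd by blast
  have bound: "- (2 * pi * G K * exp x) \<le> flux G x" if "x \<le> 0" for x
    using abs_flux_le[OF c, of x "G K"] cutoff_mono[OF c nn K[OF that]] cutoff_nonneg[OF c nn] by auto
  have "((\<lambda>x. - (2 * pi * G K * exp x)) \<longlongrightarrow> - (2 * pi * G K * 0)) at_bot"
    by (intro tendsto_intros exp_at_bot)
  moreover have "eventually (\<lambda>x. - (2 * pi * G K * exp x) \<le> flux G s) at_bot"
    using eventually_le_at_bot[of "min 0 s"]
  proof eventually_elim
    case (elim x)
    then show ?case using bound[of x] flux_mono[OF c nn, of x s] by simp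
  qed
  ultimately show ?thesis
    using tendsto_upperbound by fastforce
qed

text \<open>A continuous nonnegative function with integral 0 vanishes. The period is started at
  \<open>t\<close> so that every \<open>t\<close> is covered.\<close>

lemma energy_zero_imp:
  assumes c: "cutoff \<epsilon> g G" and nn: "\<And>t. 0 \<le> g t" and E: "energy g s = 0"
  shows "g (v s t) * p s t = 0" "g (v s t) * q s t = 0"
proof -
  have "integral {t..t + 2 * pi} (\<lambda>t. g (v s t) * edens s t) = 0"
    using E integral_shift_period[OF slice[OF cutoff_conts(1)[OF c]], of "2 * pi" s t]
    by (simp add: energy_def v_per edens_per)
  then have "g (v s t) * edens s t = 0"
    using integral_eq_0_iff[OF slice[OF cutoff_conts(1)[OF c]], of t "t + 2 * pi" s] nn
    by (auto simp: edens_nonneg)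
  then show "g (v s t) * p s t = 0" "g (v s t) * q s t = 0"
    by (auto simp: edens_def)
qed

text \<open>With the cutoff at height \<open>\<mu>\<close> the flux vanishes at \<open>S\<close>.
  Being nonnegative and nondecreasing, it vanishes for all smaller \<open>s\<close>, and so does its
  derivative, the energy. Hence \<open>G (v s t)\<close> does not change with \<open>s\<close> and
  keeps the value 0 that it has at \<open>S\<close>.\<close>

lemma maximum_principle:
  assumes \<mu>: "0 < \<mu>" and bd: "\<And>t. v S t \<le> \<mu>" and s: "s \<le> S"
  shows "v s t \<le> \<mu>"
proof -
  define g where "g = (\<lambda>x. max 0 (x - \<mu>))"
  have "continuous_on UNIV g" unfolding g_def by (intro continuous_intros)
  with \<mu> obtain G where c: "cutoff \<mu> g G"
    by (rule cutoff_exists) (auto simp: g_def)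
  have nn: "0 \<le> g x" for x by (simp add: g_def)
  have zero: "G (v S t) = 0" for t using bd c by (auto simp: cutoff_def)
  then have "flux G S = 0" by (simp add: flux_def)
  then have flux0: "flux G x = 0" if "x \<le> S" for x
    using flux_mono[OF c nn that] flux_nonneg[OF c nn, of x] by simp
  have E0: "energy g x = 0" if x: "x < S" for x
  proof -
    have "eventually (\<lambda>y. y < S) (nhds x)"
      using x by (intro order_tendstoD(2)[OF filterlim_ident])
    then have "eventually (\<lambda>y. flux G y = 0) (nhds x)"
      by eventually_elim (auto intro: flux0)
    then have "(flux G has_real_derivative 0) (at x)"
      by (subst DERIV_cong_ev[OF refl _ refl]) auto
    then show ?thesis using flux_deriv[OF c, of x] DERIV_unique by blast
  qed
  have "G (v s t) = G (v S t)"
  proof (cases "s = S")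
    case False
    show ?thesis
    proof (rule DERIV_isconst2[of s S "\<lambda>s. G (v s t)" S, symmetric])
      show "continuous_on {s..S} (\<lambda>s. G (v s t))"
        using slice'[OF cutoff_conts(6)[OF c]] .
      show "((\<lambda>s. G (v s t)) has_real_derivative 0) (at x)" if "s < x" "x < S" for x
        using cutoff_deriv(1)[OF c, of t x] energy_zero_imp(1)[OF c nn E0[OF that(2)]] by simp
    qed (use s False in auto)
  qed simp
  then have "G (v s t) = 0" using zero by simp
  with cutoff_pos[OF c nn, of \<mu> "v s t"] show ?thesis
    by (force simp: g_def)
qed

subsection \<open>Growth of the flux\<close>

text \<open>The reason is \<open>W - 1 \<le> (W^2 - 1) / W\<close>, whose right side is
  \<open>exp (- 2 * s) * edens\<close>. The factor \<open>m\<close> turns the weight into 1 near the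
  zero set of \<open>v\<close>, where \<open>W\<close> is not controlled.\<close>

lemma length_bound:
  assumes m: "cutoff \<delta> m hm" and m01: "\<And>x. 0 \<le> m x" "\<And>x. m x \<le> 1"
  shows "integral {a..a + 2 * pi} (\<lambda>t. 1 + m (v s t) * (W s t - 1)) \<le> 2 * pi + exp (- 2 * s) * energy m s"
proof -
  have w_cont: "continuous_on UNIV (\<lambda>(s, t). m (v s t) * (W s t - 1))"
    using m W_cont by (intro cutoff_cont[of \<delta>])
      (auto simp: cutoff_def case_prod_unfold intro!: continuous_intros)
  have w_int: "(\<lambda>t. 1 + m (v s t) * (W s t - 1)) integrable_on {a..a + 2 * pi}"
    by (intro integrable_continuous_real continuous_intros slice[OF w_cont])
  have e: "((\<lambda>t. m (v s t) * edens s t) has_integral energy m s) {a..a + 2 * pi}"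
  proof -
    have "integral {a..a + 2 * pi} (\<lambda>t. m (v s t) * edens s t) = energy m s"
      using integral_shift_period[OF slice[OF cutoff_conts(1)[OF m]], of "2 * pi" s a]
      by (simp add: energy_def v_per edens_per)
    then show ?thesis
      using slice[OF cutoff_conts(1)[OF m]]
      by (metis integrable_continuous_real integrable_integral)
  qed
  have "((\<lambda>t. 1 :: real) has_integral 2 * pi) {a..a + 2 * pi}"
    using has_integral_const_real[of "1::real" a "a + 2 * pi"] by simp
  then have "((\<lambda>t. 1 + exp (- 2 * s) * (m (v s t) * edens s t)) has_integral
      2 * pi + exp (- 2 * s) * energy m s) {a..a + 2 * pi}"
    by (intro has_integral_add has_integral_mult_right e)
  moreover have "1 + m (v s t) * (W s t - 1) \<le> 1 + exp (- 2 * s) * (m (v s t) * edens s t)" for t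
  proof -
    have "W s t - 1 \<le> ((W s t)\<^sup>2 - 1) / W s t"
      using W_ge_1[of s t] by (simp add: field_simps power2_eq_square)
    also have "(W s t)\<^sup>2 - 1 = exp (- 2 * s) * ((p s t)\<^sup>2 + (q s t)\<^sup>2)"
      by (simp add: area_density_def)
    finally have "W s t - 1 \<le> exp (- 2 * s) * edens s t"
      by (simp add: edens_def)
    then show ?thesis
      using mult_left_mono[OF _ m01(1)[of "v s t"]] by (fastforce simp: algebra_simps)
  qed
  ultimately show ?thesis
    using has_integral_le[OF integrable_integral[OF w_int]] by blast
qed

text \<open>\<open>h |P|\<close> is at most \<open>H\<close> times \<open>k |P|\<close>, and this
  product is split into multiples of \<open>H^2 * W\<close> and \<open>k^2 * p^2 / W\<close>.
  Wirtinger's inequality for \<open>H (v s t)\<close>, which vanishes at \<open>a\<close> and one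
  period later, trades the first term for the \<open>q\<close> part of the energy.\<close>

lemma flux_le_length_energy:
  assumes k: "cutoff \<epsilon> k H" and h: "cutoff \<epsilon> (\<lambda>x. (k x)\<^sup>2) h"
    and hHk: "\<And>x. h x \<le> H x * k x" and k0: "\<And>x. 0 \<le> k x"
    and m: "cutoff \<delta> m hm" and m01: "\<And>x. 0 \<le> m x" "\<And>x. m x \<le> 1"
    and m1: "\<And>x. \<epsilon> < x \<Longrightarrow> m x = 1"
    and zero: "v s a = 0"
  shows "2 * pi * flux h s \<le> (2 * pi + exp (- 2 * s) * energy m s) * energy (\<lambda>x. (k x)\<^sup>2) s"
proof -
  let ?I = "{a..a + 2 * pi}"
  define w where "w = (\<lambda>t. 1 + m (v s t) * (W s t - 1))"
  define \<Lambda> where "\<Lambda> = integral ?I w"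
  \<comment> \<open>The reciprocal of \<open>\<Lambda> / pi\<close>: Wirtinger's inequality then
    bounds \<open>c\<close> times the integral of \<open>f2\<close> by \<open>1 / c\<close> times
    that of \<open>kq\<close>, matching the factor in front of \<open>kp\<close>.\<close>
  define c where "c = pi / \<Lambda>"
  have \<epsilon>: "0 < \<epsilon>" and low: "\<And>x. x \<le> \<epsilon> \<Longrightarrow> k x = 0 \<and> H x = 0 \<and> h x = 0"
    using k h by (auto simp: cutoff_def)
  have "continuous_on UNIV (\<lambda>(s, t). m (v s t) * (W s t - 1))"
    using m W_cont by (intro cutoff_cont[of \<delta>])
      (auto simp: cutoff_def case_prod_unfold intro!: continuous_intros)
  then have w_cont: "continuous_on A w" for A
    unfolding w_def by (intro continuous_intros slice)
  have w1: "1 \<le> w t" for t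
    using W_ge_1[of s t] m01(1)[of "v s t"] by (simp add: w_def)
  then have w_pos: "0 < w t" for t by (meson less_le_trans zero_less_one)
  have w_eq: "w t = W s t" if "\<epsilon> < v s t" for t
    using m1[OF that] by (simp add: w_def)
  have "integral ?I (\<lambda>t. 1) \<le> \<Lambda>"
    unfolding \<Lambda>_def by (intro integral_le integrable_continuous_real w_cont) (use w1 in auto)
  then have "2 * pi \<le> \<Lambda>" by simp
  then have \<Lambda>: "0 < \<Lambda>"
    by (rule less_le_trans[rotated]) simp
  then have c: "0 < c" by (simp add: c_def)

  define f2 where "f2 = (\<lambda>t. (H (v s t))\<^sup>2 * w t)"
  define kp where "kp = (\<lambda>t. (k (v s t))\<^sup>2 * ((p s t)\<^sup>2 / W s t))"
  define kq where "kq = (\<lambda>t. (k (v s t))\<^sup>2 * ((q s t)\<^sup>2 / W s t))"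
  have f2_int: "f2 integrable_on ?I"
    unfolding f2_def by (intro integrable_continuous_real continuous_intros w_cont slice[OF cutoff_conts(6)[OF k]])
  have k2: "continuous_on UNIV (\<lambda>x. (k x)\<^sup>2)" "\<And>x. x \<le> \<epsilon> \<Longrightarrow> (k x)\<^sup>2 = 0"
    using h by (auto simp: cutoff_def)
  have "continuous_on UNIV (\<lambda>(s, t). (k (v s t))\<^sup>2 * ((p s t)\<^sup>2 / W s t))"
    using p_cont W_cont
    by (intro cutoff_cont[OF \<epsilon> k2]) (auto simp: case_prod_unfold intro!: continuous_intros)
  then have kp_int: "kp integrable_on ?I"
    unfolding kp_def by (intro integrable_continuous_real slice)
  have "continuous_on UNIV (\<lambda>(s, t). (k (v s t))\<^sup>2 * ((q s t)\<^sup>2 / W s t))"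
    using q_cont W_cont
    by (intro cutoff_cont[OF \<epsilon> k2]) (auto simp: case_prod_unfold intro!: continuous_intros)
  then have kq_int: "kq integrable_on ?I"
    unfolding kq_def by (intro integrable_continuous_real slice)
  have energy: "integral ?I kp + integral ?I kq = energy (\<lambda>x. (k x)\<^sup>2) s"
  proof -
    have "integral ?I kp + integral ?I kq = integral ?I (\<lambda>t. kp t + kq t)"
      by (rule integral_add[OF kp_int kq_int, symmetric])
    also have "\<dots> = integral ?I (\<lambda>t. (k (v s t))\<^sup>2 * edens s t)"
      by (simp add: kp_def kq_def edens_def algebra_simps add_divide_distrib)
    also have "\<dots> = energy (\<lambda>x. (k x)\<^sup>2) s"
      unfolding energy_def
      by (rule integral_shift_period[OF slice[OF cutoff_conts(1)[OF h]]]) (auto simp: v_per edens_per)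
    finally show ?thesis .
  qed
  have "integral ?I f2 \<le> (\<Lambda> / pi)\<^sup>2 * integral ?I (\<lambda>t. (k (v s t) * q s t)\<^sup>2 / w t)"
    unfolding f2_def \<Lambda>_def
    by (rule weighted_wirtinger[OF _ cutoff_deriv(2)[OF k] slice[OF cutoff_conts(5)[OF k]] w_cont w_pos])
      (use zero low[of 0] \<epsilon> v_per[of s a] in auto)
  \<comment> \<open>Where \<open>v > \<epsilon>\<close> the weight \<open>w\<close> is
    \<open>W\<close>; elsewhere \<open>k\<close> is 0.\<close>
  also have "(\<lambda>t. (k (v s t) * q s t)\<^sup>2 / w t) = kq"
  proof
    show "(k (v s t) * q s t)\<^sup>2 / w t = kq t" for t
      by (cases "\<epsilon> < v s t") (auto simp: kq_def power_mult_distrib w_eq low)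
  qed
  finally have wirt: "c * integral ?I f2 \<le> integral ?I kq / c"
    using c \<Lambda> by (simp add: c_def field_simps power2_eq_square)
  have P_int: "(\<lambda>t. h (v s t) * P s t) integrable_on ?I"
    by (intro integrable_continuous_real slice[OF cutoff_conts(2)[OF h]])
  have "2 * flux h s = integral ?I (\<lambda>t. 2 * (h (v s t) * P s t))"
    unfolding flux_def
    using integral_shift_period[OF slice[OF cutoff_conts(2)[OF h]], of "2 * pi" s a]
    by (simp add: v_per P_per)
  also have "\<dots> \<le> integral ?I (\<lambda>t. c * f2 t + kp t / c)"
  proof (rule integral_le)
    show "2 * (h (v s t) * P s t) \<le> c * f2 t + kp t / c" for t
    proof (cases "\<epsilon> < v s t")
      case True
      let ?H = "H (v s t)" and ?k = "k (v s t)" and ?h = "h (v s t)"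
      have "?h * P s t \<le> ?h * \<bar>P s t\<bar>"
        using cutoff_nonneg[OF h, of "v s t"] by (intro mult_left_mono) auto
      also have "\<dots> \<le> ?H * ?k * \<bar>P s t\<bar>"
        by (intro mult_right_mono hHk) auto
      finally have 1: "2 * (?h * P s t) \<le> (2 * ?H * ?k * \<bar>p s t\<bar>) / W s t"
        by (simp add: P_def algebra_simps)
      have "0 \<le> (c * ?H - ?k * \<bar>p s t\<bar>)\<^sup>2 / (c * W s t)"
        using c by (intro divide_nonneg_pos) auto
      also have "\<dots> = c * ?H\<^sup>2 / W s t + kp t / c - (2 * ?H * ?k * \<bar>p s t\<bar>) / W s t"
        using c by (simp add: kp_def power2_diff field_simps power2_eq_square abs_mult_self_eq)
      finally have 2: "(2 * ?H * ?k * \<bar>p s t\<bar>) / W s t \<le> c * ?H\<^sup>2 / W s t + kp t / c"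
        by simp
      \<comment> \<open>By \<open>W \<ge> 1\<close>; this puts the term into the weighted form that
        Wirtinger's inequality controls.\<close>
      have "?H\<^sup>2 / W s t \<le> ?H\<^sup>2 * W s t"
        using mult_left_mono[OF mult_mono[OF W_ge_1 W_ge_1, of s t s t], of "?H\<^sup>2"]
        by (simp add: divide_le_eq mult.assoc less_imp_le)
      then have 3: "c * ?H\<^sup>2 / W s t \<le> c * f2 t"
        using c mult_left_mono[of "?H\<^sup>2 / W s t" "?H\<^sup>2 * W s t" c] by (simp add: f2_def w_eq[OF True])
      from 1 2 3 show ?thesis by linarith
    qed (use low in \<open>simp add: f2_def kp_def\<close>)
  qed (use P_int f2_int kp_int in \<open>auto intro!: integrable_add simp: integrable_on_mult_right integrable_on_divide\<close>)
  also have "\<dots> = c * integral ?I f2 + integral ?I kp / c"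
    using f2_int kp_int by (subst integral_add) (auto simp: integrable_on_mult_right integrable_on_divide)
  also have "\<dots> \<le> (integral ?I kp + integral ?I kq) / c"
    using wirt by (simp add: add_divide_distrib)
  finally have "2 * flux h s \<le> energy (\<lambda>x. (k x)\<^sup>2) s * \<Lambda> / pi"
    by (simp add: energy c_def)
  then have "2 * pi * flux h s \<le> \<Lambda> * energy (\<lambda>x. (k x)\<^sup>2) s"
    using pi_gt_zero by (simp add: field_simps)
  also have "\<Lambda> \<le> 2 * pi + exp (- 2 * s) * energy m s"
    using length_bound[OF m m01] by (simp add: \<Lambda>_def w_def)
  finally show ?thesis
    using energy_nonneg[OF h] by (simp add: mult_right_mono)
qed

text \<open>Cauchy-Schwarz in the form \<open>2 * a * b \<le> c * a^2 + b^2 / c\<close>, together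
  with \<open>P^2 \<le> edens\<close>.\<close>

lemma flux_squared_le:
  assumes k: "cutoff \<epsilon> k H" and h: "cutoff \<epsilon> (\<lambda>x. (k x)\<^sup>2) h"
    and hHk: "\<And>x. h x \<le> H x * k x" and k0: "\<And>x. 0 \<le> k x"
    and M: "\<And>t. H (v s t) \<le> M" and M0: "0 < M"
  shows "(flux h s)\<^sup>2 \<le> 2 * pi * M\<^sup>2 * energy (\<lambda>x. (k x)\<^sup>2) s"
proof (cases "flux h s = 0")
  case True
  then show ?thesis using energy_nonneg[OF h, of s] M0 by simp
next
  case False
  let ?I = "{0..2 * pi}"
  have h0: "0 \<le> h x" for x by (rule cutoff_nonneg[OF h]) simp
  have A: "0 < flux h s" using False flux_nonneg[OF h, of s] by simp
  \<comment> \<open>Chosen so that \<open>2 * pi * (c * M^2)\<close> equals the flux and cancels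
    half of \<open>2 * flux h s\<close>.\<close>
  define c where "c = flux h s / (2 * pi * M\<^sup>2)"
  have c: "0 < c" using A M0 by (simp add: c_def)
  have E_int: "(\<lambda>t. (k (v s t))\<^sup>2 * edens s t) integrable_on ?I"
    by (intro integrable_continuous_real slice[OF cutoff_conts(1)[OF h]])
  have P_int: "(\<lambda>t. h (v s t) * P s t) integrable_on ?I"
    by (intro integrable_continuous_real slice[OF cutoff_conts(2)[OF h]])
  have "2 * flux h s = integral ?I (\<lambda>t. 2 * (h (v s t) * P s t))"
    unfolding flux_def by simp
  also have "\<dots> \<le> integral ?I (\<lambda>t. c * M\<^sup>2 + (k (v s t))\<^sup>2 * edens s t / c)"
  proof (rule integral_le)
    show "2 * (h (v s t) * P s t) \<le> c * M\<^sup>2 + (k (v s t))\<^sup>2 * edens s t / c" for t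
    proof -
      let ?H = "H (v s t)" and ?k = "k (v s t)" and ?h = "h (v s t)"
      have "?h * P s t \<le> ?h * \<bar>P s t\<bar>"
        using h0 by (intro mult_left_mono) auto
      also have "\<dots> \<le> ?H * ?k * \<bar>P s t\<bar>"
        by (intro mult_right_mono hHk) auto
      also have "\<dots> \<le> M * ?k * \<bar>P s t\<bar>"
        by (intro mult_right_mono M k0) auto
      finally have 1: "2 * (?h * P s t) \<le> 2 * M * (?k * \<bar>P s t\<bar>)" by simp
      have "0 \<le> (c * M - ?k * \<bar>P s t\<bar>)\<^sup>2 / c"
        using c by (intro divide_nonneg_pos) auto
      also have "\<dots> = c * M\<^sup>2 + (?k)\<^sup>2 * (P s t)\<^sup>2 / c - 2 * M * (?k * \<bar>P s t\<bar>)"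
        using c by (simp add: power2_diff field_simps power2_eq_square abs_mult_self_eq)
      finally have 2: "2 * M * (?k * \<bar>P s t\<bar>) \<le> c * M\<^sup>2 + (?k)\<^sup>2 * (P s t)\<^sup>2 / c" by simp
      have "(P s t)\<^sup>2 = (p s t)\<^sup>2 / W s t / W s t"
        by (simp add: P_def power2_eq_square)
      also have "\<dots> \<le> (p s t)\<^sup>2 / W s t / 1"
        using W_ge_1[of s t] by (intro divide_left_mono) auto
      also have "\<dots> \<le> edens s t"
        unfolding edens_def div_by_1 by (intro divide_right_mono) (auto simp: less_imp_le)
      finally have "(?k)\<^sup>2 * (P s t)\<^sup>2 / c \<le> (?k)\<^sup>2 * edens s t / c"
        using c by (intro divide_right_mono mult_left_mono) auto
      with 1 2 show ?thesis by linarith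
    qed
  qed (use P_int E_int in \<open>auto intro!: integrable_add simp: integrable_on_mult_right integrable_on_divide integrable_const_ivl\<close>)
  also have "\<dots> = 2 * pi * (c * M\<^sup>2) + energy (\<lambda>x. (k x)\<^sup>2) s / c"
    using E_int by (subst integral_add) (auto simp: integrable_on_divide energy_def integrable_const_ivl)
  also have "2 * pi * (c * M\<^sup>2) = flux h s"
    using M0 by (simp add: c_def)
  finally have "flux h s \<le> energy (\<lambda>x. (k x)\<^sup>2) s / c" by simp
  then have "flux h s * flux h s \<le> 2 * pi * M\<^sup>2 * energy (\<lambda>x. (k x)\<^sup>2) s"
    using A M0 by (simp add: c_def field_simps)
  then show ?thesis by (simp add: power2_eq_square)
qed

text \<open>With \<open>x = exp (- 2 * s) * ?F s / (2 * pi)\<close> the length bound gives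
  \<open>?E s / ?A s \<ge> 1 / (1 + x) \<ge> 1 - x\<close>, a lower bound for the derivative of
  \<open>ln (?A s)\<close>. On intervals where \<open>?A s \<le> exp s\<close> the integral of
  \<open>x\<close> stays bounded; where \<open>?A s \<ge> exp s\<close> any \<open>L \<le> 0\<close>
  will do.\<close>

lemma flux_growth:
  assumes k: "cutoff \<epsilon> k H" and h: "cutoff \<epsilon> (\<lambda>x. (k x)\<^sup>2) h"
    and hHk: "\<And>x. h x \<le> H x * k x" and k0: "\<And>x. 0 \<le> k x"
    and m: "cutoff \<delta> m hm" and m01: "\<And>x. 0 \<le> m x" "\<And>x. m x \<le> 1"
    and m1: "\<And>x. \<epsilon> < x \<Longrightarrow> m x = 1"
    and C: "0 \<le> C" "\<And>s. flux hm s \<le> flux h s + C * exp s"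
    and zero: "\<And>s. \<sigma> \<le> s \<Longrightarrow> \<exists>t. v s t = 0"
    and pos: "0 < flux h \<sigma>" and \<sigma>: "0 \<le> \<sigma>"
  shows "\<exists>L. \<forall>s\<ge>\<sigma>. exp (L + s) \<le> flux h s"
proof -
  let ?A = "flux h" and ?B = "flux hm"
  let ?E = "energy (\<lambda>x. (k x)\<^sup>2)" and ?F = "energy m"
  \<comment> \<open>Where \<open>?A s \<le> exp s\<close>, the comparison of the two fluxes gives
    \<open>?B s \<le> (1 + C) * exp s\<close>, hence
    \<open>exp (- 2 * s) * ?B s / pi \<le> c * exp (- s)\<close>.\<close>
  define c where "c = (1 + C) / pi"
  have c: "0 \<le> c" using C by (simp add: c_def)
  have B0: "0 \<le> ?B s" for s by (rule flux_nonneg[OF m m01(1)])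
  have A_pos: "0 < ?A s" if "\<sigma> \<le> s" for s
    using flux_mono[OF h _ that] pos by simp
  \<comment> \<open>The term with \<open>?B\<close> comes from integrating the error \<open>exp (- 2 * s) * ?F s\<close> by parts; the last one
    absorbs what is left as long as \<open>?A s \<le> exp s\<close>.\<close>
  define \<Theta> where "\<Theta> = (\<lambda>s. ln (?A s) - s + exp (- 2 * s) * ?B s / (2 * pi) - c * exp (- s))"
  define \<Theta>' where "\<Theta>' = (\<lambda>s. ?E s / ?A s - 1 + exp (- 2 * s) * ?F s / (2 * pi)
      - exp (- 2 * s) * ?B s / pi + c * exp (- s))"
  have \<Theta>_deriv: "(\<Theta> has_real_derivative \<Theta>' s) (at s)" if "\<sigma> \<le> s" for s
    unfolding \<Theta>_def \<Theta>'_def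
    using A_pos[OF that]
    by (auto intro!: derivative_eq_intros flux_deriv[OF h] flux_deriv[OF m] simp: field_simps)
  have \<Theta>'_nonneg: "0 \<le> \<Theta>' s" if s: "\<sigma> \<le> s" and le: "?A s \<le> exp s" for s
  proof -
    define x where "x = exp (- 2 * s) * ?F s / (2 * pi)"
    have x: "0 \<le> x" using energy_nonneg[OF m m01(1)] by (simp add: x_def)
    have E: "0 \<le> ?E s" using energy_nonneg[OF h] by simp
    obtain t where "v s t = 0" using zero[OF s] by blast
    from flux_le_length_energy[OF k h hHk k0 m m01 m1 this]
    have *: "?A s \<le> (1 + x) * ?E s"
      by (simp add: x_def field_simps)
    \<comment> \<open>From \<open>(1 + x) * (1 - x) \<le> 1\<close>; for \<open>x > 1\<close> the
      left side is negative.\<close>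
    have "?A s * (1 - x) \<le> ?E s"
    proof (cases "x \<le> 1")
      case True
      have "?A s * (1 - x) \<le> (1 + x) * ?E s * (1 - x)"
        using True * by (intro mult_right_mono) auto
      also have "\<dots> = ?E s - x\<^sup>2 * ?E s" by (simp add: algebra_simps power2_eq_square)
      also have "\<dots> \<le> ?E s" using E by simp
      finally show ?thesis .
    next
      case False
      then have "?A s * (1 - x) \<le> 0" using A_pos[OF s] by (intro mult_nonneg_nonpos) auto
      then show ?thesis using E by simp
    qed
    then have "1 - x \<le> ?E s / ?A s"
      using A_pos[OF s] by (simp add: field_simps)
    moreover have "exp (- 2 * s) * ?B s / pi \<le> c * exp (- s)"
    proof -
      have "?B s \<le> (1 + C) * exp s" using C(2)[of s] le by (simp add: algebra_simps)
      then have "exp (- 2 * s) * ?B s / pi \<le> exp (- 2 * s) * ((1 + C) * exp s) / pi"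
        by (intro divide_right_mono mult_left_mono) auto
      also have "\<dots> = c * (exp (- 2 * s) * exp s)" by (simp add: c_def)
      also have "exp (- 2 * s) * exp s = exp (- s)" by (simp flip: exp_add)
      finally show ?thesis .
    qed
    ultimately show ?thesis by (simp add: \<Theta>'_def x_def)
  qed
  \<comment> \<open>Passing between \<open>\<Theta>\<close> and \<open>ln (?A s) - s\<close> costs
    \<open>c\<close> at each end: at \<open>a\<close> the \<open>?B\<close> term is nonnegative, and
    at \<open>b\<close> it is at most \<open>c\<close> because
    \<open>?A b \<le> exp b\<close>.\<close>
  have step: "ln (?A a) - a - 2 * c \<le> ln (?A b) - b"
    if a: "\<sigma> \<le> a" "a \<le> b" and b: "?A b \<le> exp b" and le: "\<And>s. a < s \<Longrightarrow> s < b \<Longrightarrow> ?A s \<le> exp s" for a b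
  proof -
    have "\<Theta> a \<le> \<Theta> b"
    proof (rule DERIV_nonneg_imp_increasing_open[OF a(2)])
      show "\<exists>y. (\<Theta> has_real_derivative y) (at x) \<and> 0 \<le> y" if "a < x" "x < b" for x
        using \<Theta>_deriv[of x] \<Theta>'_nonneg[of x] le[OF that] that a by auto
      show "continuous_on {a..b} \<Theta>"
        using \<Theta>_deriv a
        by (intro DERIV_continuous_on[where D = \<Theta>']) (metis a(1) atLeastAtMost_iff has_field_derivative_at_within order_trans)
    qed
    moreover have "ln (?A a) - a - c \<le> \<Theta> a"
    proof -
      have "0 \<le> exp (- 2 * a) * ?B a / (2 * pi)" using B0 by simp
      moreover have "c * exp (- a) \<le> c"
        using c a \<sigma> by (simp add: mult_left_le)
      ultimately show ?thesis by (simp add: \<Theta>_def)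
    qed
    moreover have "\<Theta> b \<le> ln (?A b) - b + c"
    proof -
      have "?B b \<le> (1 + C) * exp b" using C(2)[of b] b by (simp add: algebra_simps)
      then have "exp (- 2 * b) * ?B b / (2 * pi) \<le> exp (- 2 * b) * ((1 + C) * exp b) / (2 * pi)"
        by (intro divide_right_mono mult_left_mono) auto
      also have "\<dots> = c / 2 * (exp (- 2 * b) * exp b)" by (simp add: c_def mult_ac)
      also have "exp (- 2 * b) * exp b = exp (- b)" by (simp flip: exp_add)
      also have "c / 2 * exp (- b) \<le> c"
        using c a \<sigma> mult_left_le[of "exp (- b)" "c / 2"] by simp
      finally have "exp (- 2 * b) * ?B b / (2 * pi) \<le> c" .
      moreover have "0 \<le> c * exp (- b)" using c by simp
      ultimately show ?thesis by (simp add: \<Theta>_def)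
    qed
    ultimately show ?thesis by linarith
  qed
  \<comment> \<open>The minimum covers both starting points used below: \<open>\<sigma>\<close>
    itself, or the last point with \<open>exp s \<le> ?A s\<close>, where
    \<open>ln (?A s) - s\<close> is nonnegative.\<close>
  define L where "L = min 0 (ln (?A \<sigma>) - \<sigma>) - 2 * c"
  have "L \<le> ln (?A b) - b" if b: "\<sigma> \<le> b" for b
  proof (cases "exp b \<le> ?A b")
    case True
    then have "b \<le> ln (?A b)" using A_pos[OF b] by (simp add: ln_ge_iff)
    then show ?thesis using c by (simp add: L_def)
  next
    case b_less: False
    define Z where "Z = {s \<in> {\<sigma>..b}. exp s \<le> ?A s}"
    show ?thesis
    proof (cases "Z = {}")
      case True
      have "?A s \<le> exp s" if "\<sigma> < s" "s < b" for s
      proof -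
        have "s \<notin> Z" using True by simp
        then show ?thesis using that by (auto simp: Z_def)
      qed
      with step[of \<sigma> b] b b_less show ?thesis by (simp add: L_def)
    next
      case False
      have "continuous_on UNIV ?A"
        using flux_deriv[OF h] by (intro DERIV_continuous_on) auto
      then have "closed ({\<sigma>..b} \<inter> {s. exp s \<le> ?A s})"
        by (intro closed_Int closed_Collect_le continuous_intros) auto
      also have "{\<sigma>..b} \<inter> {s. exp s \<le> ?A s} = Z"
        by (auto simp: Z_def)
      finally have "closed Z" .
      moreover have bdd: "bdd_above Z" by (auto simp: Z_def)
      ultimately have a: "Sup Z \<in> Z" using closed_contains_Sup False by blast
      have "?A s \<le> exp s" if "Sup Z < s" "s < b" for s
      proof -
        have "s \<notin> Z" using cSup_upper[OF _ bdd, of s] that by auto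
        then show ?thesis using that a by (auto simp: Z_def)
      qed
      with step[of "Sup Z" b] a b_less have "ln (?A (Sup Z)) - Sup Z - 2 * c \<le> ln (?A b) - b"
        by (auto simp: Z_def)
      moreover have "Sup Z \<le> ln (?A (Sup Z))"
        using a A_pos[of "Sup Z"] by (auto simp: Z_def ln_ge_iff)
      ultimately show ?thesis by (simp add: L_def)
    qed
  qed
  then have "exp (L + s) \<le> ?A s" if "\<sigma> \<le> s" for s
    using that A_pos[OF that] by (metis add.commute le_diff_eq exp_le_cancel_iff exp_ln)
  then show ?thesis by blast
qed

text \<open>The inequality \<open>?A^2 \<le> ?K * ?E\<close>, with \<open>?E\<close> the derivative
  of \<open>?A\<close>, is integrated over an interval of length 1:
  \<open>- 1 / ?A s - s / ?K\<close> is nondecreasing there. The maximum principle carries the bound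
  \<open>\<mu>\<close> from \<open>S\<close> to the whole interval.\<close>

lemma sup_squared_ge_flux:
  assumes k: "cutoff \<epsilon> k H" and h: "cutoff \<epsilon> (\<lambda>x. (k x)\<^sup>2) h"
    and hHk: "\<And>x. h x \<le> H x * k x" and k01: "\<And>x. 0 \<le> k x" "\<And>x. k x \<le> 1"
    and \<mu>: "0 < \<mu>" "\<And>t. v S t \<le> \<mu>" and pos: "0 < flux h (S - 1)"
  shows "flux h (S - 1) \<le> 2 * pi * \<mu>\<^sup>2"
proof -
  let ?A = "flux h" and ?E = "energy (\<lambda>x. (k x)\<^sup>2)"
  let ?K = "2 * pi * \<mu>\<^sup>2"
  have K: "0 < ?K" using \<mu> by simp
  have A_pos: "0 < ?A s" if "S - 1 \<le> s" for s
    using flux_mono[OF h _ that] pos by simp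
  have H_le: "H x \<le> x" if "0 \<le> x" for x
  proof -
    have "0 - H 0 \<le> x - H x"
      by (rule DERIV_nonneg_imp_nondecreasing[OF that])
        (use k k01 in \<open>auto simp: cutoff_def intro!: exI[of _ "1 - k _"] derivative_eq_intros\<close>)
    moreover have "H 0 = 0" using k by (auto simp: cutoff_def)
    ultimately show ?thesis by simp
  qed
  have "- inverse (?A (S - 1)) - (S - 1) / ?K \<le> - inverse (?A S) - S / ?K"
  proof (rule DERIV_nonneg_imp_nondecreasing[where f = "\<lambda>s. - inverse (?A s) - s / ?K"])
    fix s assume s: "S - 1 \<le> s" "s \<le> S"
    have "H (v s t) \<le> \<mu>" for t
      using H_le[OF v_nonneg, of s t] maximum_principle[OF \<mu> s(2), of t] by linarith
    then have "(?A s)\<^sup>2 \<le> ?K * ?E s"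
      using flux_squared_le[OF k h hHk k01(1)] \<mu> by blast
    then have "0 \<le> ?E s / (?A s)\<^sup>2 - 1 / ?K"
      using A_pos[OF s(1)] K by (simp add: field_simps)
    moreover have "((\<lambda>s. - inverse (?A s) - s / ?K) has_real_derivative ?E s / (?A s)\<^sup>2 - 1 / ?K) (at s)"
      using A_pos[OF s(1)] K
      by (auto intro!: derivative_eq_intros flux_deriv[OF h] simp: field_simps power2_eq_square)
    ultimately show "\<exists>y. ((\<lambda>s. - inverse (?A s) - s / ?K) has_real_derivative y) (at s) \<and> 0 \<le> y"
      by blast
  qed simp
  then have "1 / ?K + inverse (?A S) \<le> inverse (?A (S - 1))"
    by (simp add: diff_divide_distrib)
  then have "1 / ?K \<le> inverse (?A (S - 1))"
    using A_pos[of S] by (smt (verit) inverse_positive_iff_positive)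
  then show ?thesis
    using pos K by (simp add: field_simps)
qed

text \<open>The flux at \<open>S - 1\<close> is at least \<open>exp (L + (S - 1))\<close> and at
  most \<open>2 * pi * \<mu>^2\<close>. Here \<open>\<mu>\<close> is any bound for \<open>v\<close>
  at \<open>S\<close>; the maximum on the circle is inserted later.\<close>

lemma sup_growth:
  assumes pos: "0 < v s1 t1" and zero: "\<And>s. s0 \<le> s \<Longrightarrow> \<exists>t. v s t = 0"
  shows "\<exists>c>0. \<exists>S0. \<forall>S\<ge>S0. \<forall>\<mu>>0. (\<forall>t. v S t \<le> \<mu>) \<longrightarrow> c * exp (S / 2) \<le> \<mu>"
proof -
  \<comment> \<open>The value \<open>4 * \<epsilon>\<close> at \<open>(s1, t1)\<close> lies above
    all the cutoff levels, so \<open>H\<close> is positive there.\<close>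
  define \<epsilon> where "\<epsilon> = v s1 t1 / 4"
  have \<epsilon>: "0 < \<epsilon>" using pos by (simp add: \<epsilon>_def)
  \<comment> \<open>\<open>m\<close> dominates \<open>k^2\<close>, equals 1 wherever \<open>k\<close> is nonzero, and agrees with \<open>k^2\<close> above \<open>2 * \<epsilon>\<close>; so \<open>m\<close> controls
    the weight where \<open>k\<close> lives, while its flux exceeds that of \<open>k^2\<close> only by a multiple of \<open>exp s\<close>.\<close>
  define k where "k = (\<lambda>x. max 0 (min 1 (x / \<epsilon> - 1)))"
  define m where "m = (\<lambda>x. max 0 (min 1 (2 * x / \<epsilon> - 1)))"
  have conts: "continuous_on UNIV k" "continuous_on UNIV m" "continuous_on UNIV (\<lambda>x. (k x)\<^sup>2)"
    unfolding k_def m_def by (intro continuous_intros; use \<epsilon> in force)+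
  have k01: "0 \<le> k x" "k x \<le> 1" and m01: "0 \<le> m x" "m x \<le> 1" for x
    by (auto simp: k_def m_def)
  have k_low: "k x = 0" if "x \<le> \<epsilon>" for x using that \<epsilon> by (auto simp: k_def field_simps)
  have m_low: "m x = 0" if "x \<le> \<epsilon> / 2" for x using that \<epsilon> by (auto simp: m_def field_simps)
  have m_high: "m x = 1" if "\<epsilon> \<le> x" for x using that \<epsilon> by (auto simp: m_def field_simps)
  have k_high: "k x = 1" if "2 * \<epsilon> \<le> x" for x using that \<epsilon> by (auto simp: k_def field_simps)
  have k_mono: "k x \<le> k y" if "x \<le> y" for x y
    unfolding k_def using divide_right_mono[OF that, of \<epsilon>] \<epsilon> by (intro max.mono min.mono) auto
  obtain H where k: "cutoff \<epsilon> k H" using cutoff_exists[OF \<epsilon> conts(1) k_low] by blast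
  obtain h where h: "cutoff \<epsilon> (\<lambda>x. (k x)\<^sup>2) h"
    using cutoff_exists[OF \<epsilon> conts(3)] k_low by (metis zero_power2)
  obtain hm where m: "cutoff (\<epsilon> / 2) m hm"
    using cutoff_exists[of "\<epsilon> / 2" m] \<epsilon> conts(2) m_low by (metis half_gt_zero)
  \<comment> \<open>As \<open>k\<close> is nondecreasing, \<open>H y * k x - h y\<close> has the
    derivative \<open>k y * (k x - k y) \<ge> 0\<close> in \<open>y\<close> for
    \<open>y \<le> x\<close>.\<close>
  have hHk: "h x \<le> H x * k x" for x
  proof (cases "x \<le> \<epsilon>")
    case True
    then show ?thesis using h k by (auto simp: cutoff_def)
  next
    case False
    have "H 0 * k x - h 0 \<le> H x * k x - h x"
    proof (rule DERIV_nonneg_imp_nondecreasing[where f = "\<lambda>y. H y * k x - h y"])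
      fix y assume "y \<le> x"
      have "((\<lambda>y. H y * k x - h y) has_real_derivative k y * k x - (k y)\<^sup>2) (at y)"
        using h k by (auto simp: cutoff_def intro!: derivative_eq_intros)
      moreover have "0 \<le> k y * k x - (k y)\<^sup>2"
        using mult_left_mono[OF k_mono[OF \<open>y \<le> x\<close>] k01(1)[of y]] by (simp add: power2_eq_square)
      ultimately show "\<exists>d. ((\<lambda>y. H y * k x - h y) has_real_derivative d) (at y) \<and> 0 \<le> d" by blast
    qed (use False \<epsilon> in simp)
    moreover have "H 0 = 0" "h 0 = 0" using h k by (auto simp: cutoff_def)
    ultimately show ?thesis by simp
  qed
  have d: "cutoff (\<epsilon> / 2) (\<lambda>x. m x - (k x)\<^sup>2) (\<lambda>x. hm x - h x)"
    using h m by (auto simp: cutoff_def intro!: continuous_intros derivative_intros)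
  have d_nonneg: "0 \<le> m x - (k x)\<^sup>2" for x
  proof (cases "\<epsilon> \<le> x")
    case True
    then show ?thesis using k01[of x] by (simp add: m_high power_le_one)
  qed (use m01(1) k_low in simp)
  \<comment> \<open>\<open>hm - h\<close> is nondecreasing, and constant beyond
    \<open>2 * \<epsilon>\<close>, where \<open>m\<close> and \<open>k^2\<close> are both 1; so
    \<open>C\<close> is its maximum.\<close>
  define C where "C = hm (2 * \<epsilon>) - h (2 * \<epsilon>)"
  have C0: "0 \<le> C" using cutoff_nonneg[OF d d_nonneg] by (simp add: C_def)
  have d_le: "hm x - h x \<le> C" for x
  proof (cases "x \<le> 2 * \<epsilon>")
    case True
    then show ?thesis using cutoff_mono[OF d d_nonneg] by (simp add: C_def)
  next
    case False
    then have lt: "2 * \<epsilon> < x" by simp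
    have "hm x - h x = hm (2 * \<epsilon>) - h (2 * \<epsilon>)"
    proof (rule DERIV_isconst2[OF lt])
      show "continuous_on {2 * \<epsilon>..x} (\<lambda>x. hm x - h x)"
        using d by (auto simp: cutoff_def intro!: DERIV_continuous_on intro: has_field_derivative_at_within)
      show "((\<lambda>x. hm x - h x) has_real_derivative 0) (at y)" if "2 * \<epsilon> < y" "y < x" for y
      proof -
        have "((\<lambda>x. hm x - h x) has_real_derivative m y - (k y)\<^sup>2) (at y)"
          using d by (auto simp: cutoff_def)
        then show ?thesis using that \<epsilon> by (simp add: m_high k_high)
      qed
    qed (use lt in auto)
    then show ?thesis by (simp add: C_def)
  qed
  have flux_diff: "flux hm s \<le> flux h s + 2 * pi * C * exp s" for s
  proof -
    have "flux (\<lambda>x. hm x - h x) s = flux hm s - flux h s"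
      unfolding flux_def left_diff_distrib
      by (intro integral_diff integrable_continuous_real slice cutoff_conts(2)[OF h] cutoff_conts(2)[OF m])
    moreover have "flux (\<lambda>x. hm x - h x) s \<le> 2 * pi * C * exp s"
      using abs_flux_le[OF d, of s C] d_le cutoff_nonneg[OF d d_nonneg] by auto
    ultimately show ?thesis by simp
  qed
  \<comment> \<open>Otherwise flux and energy vanish identically and \<open>H (v s t)\<close> is
    constant in the plane; being 0 at a zero of \<open>v\<close>, it cannot be positive at
    \<open>(s1, t1)\<close>.\<close>
  have "\<exists>s. 0 < flux h s"
  proof (rule ccontr)
    assume "\<nexists>s. 0 < flux h s"
    then have "flux h s = 0" for s using flux_nonneg[OF h, of s]
      by (simp add: not_less order_antisym)
    then have "flux h = (\<lambda>_. 0)" by blast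
    then have "(flux h has_real_derivative 0) (at s)" for s by simp
    then have "energy (\<lambda>x. (k x)\<^sup>2) s = 0" for s using flux_deriv[OF h] DERIV_unique by blast
    from energy_zero_imp[OF h _ this] have kp: "k (v s t) * p s t = 0" "k (v s t) * q s t = 0" for s t
      by auto
    obtain t where t: "v s0 t = 0" using zero by blast
    have "H (v s1 t1) = H (v s0 t1)"
      by (rule DERIV_isconst_all[of "\<lambda>s. H (v s t1)"]) (use cutoff_deriv(1)[OF k] kp in simp)
    also have "\<dots> = H (v s0 t)"
      by (rule DERIV_isconst_all) (use cutoff_deriv(2)[OF k] kp in simp)
    also have "\<dots> = 0" using t k by (auto simp: cutoff_def)
    finally have "H (v s1 t1) = 0" .
    moreover have "0 < H (v s1 t1)"
      by (rule cutoff_pos[OF k k01(1), of \<epsilon>]) (use \<epsilon> in \<open>auto simp: k_def field_simps \<epsilon>_def\<close>)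
    ultimately show False by simp
  qed
  then obtain s2 where s2: "0 < flux h s2" by blast
  define \<sigma> where "\<sigma> = max 0 (max s0 s2)"
  have A\<sigma>: "0 < flux h s" if "\<sigma> \<le> s" for s
    using flux_mono[OF h, of s2 s] s2 that by (auto simp: \<sigma>_def)
  obtain L where L: "\<And>s. \<sigma> \<le> s \<Longrightarrow> exp (L + s) \<le> flux h s"
  proof -
    have "\<exists>L. \<forall>s\<ge>\<sigma>. exp (L + s) \<le> flux h s"
      by (rule flux_growth[OF k h hHk k01(1) m m01 _ _ flux_diff _ A\<sigma>])
        (use m_high C0 zero in \<open>auto simp: \<sigma>_def\<close>)
    then show ?thesis using that by blast
  qed
  \<comment> \<open>Chosen so that
    \<open>c^2 * exp S = exp (L + (S - 1)) / (2 * pi)\<close>.\<close>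
  define c where "c = sqrt (exp (L - 1) / (2 * pi))"
  have "c * exp (S / 2) \<le> \<mu>" if S: "\<sigma> + 1 \<le> S" and \<mu>: "0 < \<mu>" "\<And>t. v S t \<le> \<mu>" for S \<mu>
  proof -
    have "exp (S / 2) * exp (S / 2) = exp S" "exp (L - 1) * exp S = exp (L + (S - 1))"
      by (simp_all flip: exp_add)
    then have "(c * exp (S / 2))\<^sup>2 = exp (L + (S - 1)) / (2 * pi)"
      by (simp add: c_def power_mult_distrib) (simp add: power2_eq_square)
    also have "\<dots> \<le> flux h (S - 1) / (2 * pi)"
      using L[of "S - 1"] S by (intro divide_right_mono) auto
    also have "\<dots> \<le> \<mu>\<^sup>2"
      using sup_squared_ge_flux[OF k h hHk k01 \<mu> A\<sigma>] S by (simp add: field_simps)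
    finally show ?thesis by (rule power2_le_imp_le) (use \<mu>(1) in simp)
  qed
  moreover have "0 < c" by (simp add: c_def)
  ultimately show ?thesis by (intro exI[of _ c] conjI exI[of _ "\<sigma> + 1"]) auto
qed

end

subsection \<open>Transfer from the plane\<close>

text \<open>The derivative is explicit, \<open>n' / r - (n \<bullet> n') n / r^3\<close>. It ensures
  that the divergence in the minimal surface equation is taken of a differentiable field.\<close>

lemma C1_on_normalized_gradient:
  fixes n :: "complex \<Rightarrow> complex"
  assumes n: "C1_on D n"
  shows "C1_on D (\<lambda>z. n z /\<^sub>R sqrt (1 + (norm (n z))\<^sup>2))" (is "C1_on D ?V")
proof -
  define r where "r = (\<lambda>z. sqrt (1 + (norm (n z))\<^sup>2))"
  have r: "0 < r z" for z by (auto simp: r_def intro: add_pos_nonneg)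
  have r0: "r z \<noteq> 0" for z using r[of z] by simp
  have V_eq: "?V = (\<lambda>z. n z /\<^sub>R r z)"
    by (simp add: r_def)
  have n_diff: "n differentiable (at z)" if "z \<in> D" for z
    using n that by (auto simp: C1_on_def)
  have deriv: "(?V has_derivative (\<lambda>h. frechet_derivative n (at z) h /\<^sub>R r z
      - ((n z \<bullet> frechet_derivative n (at z) h) / (r z) ^ 3) *\<^sub>R n z)) (at z)" if z: "z \<in> D" for z
  proof -
    let ?n' = "frechet_derivative n (at z)"
    have n': "(n has_derivative ?n') (at z)"
      using n_diff[OF z] by (simp add: frechet_derivative_works)
    have d: "((\<lambda>z. 1 + n z \<bullet> n z) has_derivative (\<lambda>h. 2 * (n z \<bullet> ?n' h))) (at z)"
      using has_derivative_add[OF has_derivative_const[of 1] has_derivative_inner[OF n' n']]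
      by (simp add: inner_commute)
    have "0 < 1 + n z \<bullet> n z"
      by (intro add_pos_nonneg) auto
    from has_derivative_real_sqrt[OF this d]
    have "(r has_derivative (\<lambda>h. 2 * (n z \<bullet> ?n' h) * (inverse (r z) / 2))) (at z)"
      unfolding r_def power2_norm_eq_inner .
    then have "(r has_derivative (\<lambda>h. (n z \<bullet> ?n' h) / r z)) (at z)"
      by (rule has_derivative_eq_rhs) (simp add: inverse_eq_divide)
    then have "((\<lambda>z. inverse (r z)) has_derivative
        (\<lambda>h. - (inverse (r z) * ((n z \<bullet> ?n' h) / r z) * inverse (r z)))) (at z)"
      using r[of z] by (intro Deriv.has_derivative_inverse) auto
    from has_derivative_scaleR[OF this n'] show ?thesis
      unfolding V_eq
    proof (rule has_derivative_eq_rhs, intro ext)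
      fix h
      have "- (inverse (r z) * (n z \<bullet> ?n' h / r z) * inverse (r z)) = - (n z \<bullet> ?n' h / r z ^ 3)"
        by (simp only: divide_inverse power3_eq_cube inverse_mult_distrib mult_ac)
      then show "inverse (r z) *\<^sub>R ?n' h + - (inverse (r z) * (n z \<bullet> ?n' h / r z) * inverse (r z)) *\<^sub>R n z
          = ?n' h /\<^sub>R r z - (n z \<bullet> ?n' h / r z ^ 3) *\<^sub>R n z"
        by (simp only: scaleR_minus_left) simp
    qed
  qed
  have n_cont: "continuous_on D n"
    using n_diff by (meson differentiable_imp_continuous_within continuous_at_imp_continuous_on)
  then have r_cont: "continuous_on D r" unfolding r_def by (intro continuous_intros)
  have "continuous_on D (\<lambda>z. frechet_derivative ?V (at z) b)" if b: "b \<in> Basis" for b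
  proof (rule continuous_on_eq)
    have nb: "continuous_on D (\<lambda>z. frechet_derivative n (at z) b)"
      using n b by (simp add: C1_on_def)
    show "continuous_on D (\<lambda>z. frechet_derivative n (at z) b /\<^sub>R r z
      - ((n z \<bullet> frechet_derivative n (at z) b) / (r z) ^ 3) *\<^sub>R n z)"
      by (intro continuous_intros nb n_cont r_cont) (simp_all add: r0)
    show "frechet_derivative n (at z) b /\<^sub>R r z
      - ((n z \<bullet> frechet_derivative n (at z) b) / (r z) ^ 3) *\<^sub>R n z = frechet_derivative ?V (at z) b"
      if "z \<in> D" for z
      using fun_cong[OF frechet_derivative_at[OF deriv[OF that]], of b] by simp
  qed
  with deriv show ?thesis
    by (auto simp: C1_on_def differentiable_def)
qed

text \<open>The coordinate vectors at \<open>z = E s t\<close> are \<open>z\<close> and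
  \<open>\<i> * z\<close>, so the two flux components are \<open>V z \<bullet> z\<close> and
  \<open>V z \<bullet> (\<i> * z)\<close>. Their \<open>s\<close>- and \<open>t\<close>-derivatives
  add up to \<open>|z|^2\<close> times the divergence of \<open>V\<close>, since the terms from
  differentiating \<open>z\<close> and \<open>\<i> * z\<close> cancel.\<close>

lemma minimal_graph_log_coordinates:
  fixes D :: "complex set" and u :: "complex \<Rightarrow> real"
  defines "U \<equiv> (\<lambda>z. if z \<in> D then u z else 0)"
  defines "V \<equiv> (\<lambda>z. gradient u z /\<^sub>R sqrt (1 + (norm (gradient u z))\<^sup>2))"
  defines "E \<equiv> (\<lambda>s t. exp (Complex s t))"
  assumes "open D"
    and C2: "C2_on D u" and U_cont: "continuous_on UNIV U"
    and mse: "minimal_surface_eq_on D u"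
    and pos: "\<And>z. z \<in> D \<Longrightarrow> u z > 0"
  shows "log_minimal_graph (\<lambda>s t. U (E s t))
    (\<lambda>s t. gradient u (E s t) \<bullet> E s t) (\<lambda>s t. gradient u (E s t) \<bullet> (\<i> * E s t))
    (\<lambda>s t. frechet_derivative V (at (E s t)) (E s t) \<bullet> E s t + V (E s t) \<bullet> E s t)"
proof -
  let ?n = "gradient u"
  let ?DV = "\<lambda>z. frechet_derivative V (at z)"
  have Upos: "0 < U z \<longleftrightarrow> z \<in> D" for z using pos by (auto simp: U_def)
  have per: "E s (t + 2 * pi) = E s t" for s t
  proof -
    have "Complex s (t + 2 * pi) = Complex s t + of_real (2 * pi) * \<i>"
      by (simp add: complex_eq_iff)
    then show ?thesis by (simp add: E_def exp_add exp_two_pi_i')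
  qed
  have norm_E: "cmod (E s t) = exp s" for s t by (simp add: E_def)
  have E_cont: "continuous_on A (\<lambda>x. E (fst x) (snd x))" for A
    unfolding E_def by (intro continuous_intros)
  have E_s: "((\<lambda>s. E s t) has_vector_derivative E s t) (at s)" for s t
  proof -
    have "((\<lambda>s. Complex s t) has_vector_derivative 1) (at s)"
      unfolding Complex_eq by (auto intro!: derivative_eq_intros)
    from field_vector_diff_chain_at[OF this DERIV_exp] show ?thesis by (simp add: E_def o_def)
  qed
  have E_t: "((\<lambda>t. E s t) has_vector_derivative \<i> * E s t) (at t)" for s t
  proof -
    have "((\<lambda>t. Complex s t) has_vector_derivative \<i>) (at t)"
      unfolding Complex_eq by (auto intro!: derivative_eq_intros)
    from field_vector_diff_chain_at[OF this DERIV_exp] show ?thesis by (simp add: E_def o_def)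
  qed
  have u_C1: "C1_on D u" and n_C1: "C1_on D ?n" using C2 by (auto simp: C2_on_def)
  have V_C1: "C1_on D V" unfolding V_def by (rule C1_on_normalized_gradient[OF n_C1])
  have n_cont: "continuous_on D ?n"
    using n_C1 unfolding C1_on_def
    by (meson differentiable_imp_continuous_within continuous_at_imp_continuous_on)
  have V_cont: "continuous_on D V"
    using V_C1 unfolding C1_on_def
    by (meson differentiable_imp_continuous_within continuous_at_imp_continuous_on)
  have u': "(U has_derivative (\<lambda>h. h \<bullet> ?n z)) (at z)" if z: "z \<in> D" for z
  proof -
    have "(u has_derivative (\<lambda>h. h \<bullet> ?n z)) (at z)"
      using GDERIV_gradient u_C1 z by (auto simp: C1_on_def gderiv_def)
    then show ?thesis
      by (rule has_derivative_transform_within_open[OF _ \<open>open D\<close> z]) (simp add: U_def)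
  qed
  have V': "(V has_derivative ?DV z) (at z)" if "z \<in> D" for z
    using V_C1 that by (auto simp: C1_on_def frechet_derivative_works)
  have V'_lin: "?DV z h = Re h *\<^sub>R ?DV z 1 + Im h *\<^sub>R ?DV z \<i>" if "z \<in> D" for z h
  proof -
    interpret bounded_linear "?DV z" using V'[OF that] by (rule has_derivative_bounded_linear)
    have "h = Re h *\<^sub>R 1 + Im h *\<^sub>R \<i>" by (simp add: complex_eq_iff)
    then show ?thesis by (metis add scaleR)
  qed
  have div0: "?DV z 1 \<bullet> 1 + ?DV z \<i> \<bullet> \<i> = 0" if "z \<in> D" for z
    using mse that by (simp add: minimal_surface_eq_on_def divergence_def V_def Basis_complex_def)
  \<comment> \<open>\<open>h\<close> and \<open>\<i> * h\<close> are orthogonal and of equal length,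
    so this is \<open>|h|^2\<close> times the trace of the derivative of \<open>V\<close>.\<close>
  have trace: "?DV z h \<bullet> h + ?DV z (\<i> * h) \<bullet> (\<i> * h) = 0" if "z \<in> D" for z h
  proof -
    have "?DV z h \<bullet> h + ?DV z (\<i> * h) \<bullet> (\<i> * h) = ((Re h)\<^sup>2 + (Im h)\<^sup>2) * (?DV z 1 \<bullet> 1 + ?DV z \<i> \<bullet> \<i>)"
      unfolding V'_lin[OF that, of h] V'_lin[OF that, of "\<i> * h"]
      by (simp add: inner_complex_def algebra_simps power2_eq_square)
    then show ?thesis using div0[OF that] by simp
  qed
  have W: "area_density (\<lambda>s t. ?n (E s t) \<bullet> E s t) (\<lambda>s t. ?n (E s t) \<bullet> (\<i> * E s t)) s t
      = sqrt (1 + (norm (?n (E s t)))\<^sup>2)" for s t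
  proof -
    let ?a = "?n (E s t)" and ?z = "E s t"
    have "(?a \<bullet> ?z)\<^sup>2 + (?a \<bullet> (\<i> * ?z))\<^sup>2 = (norm ?a)\<^sup>2 * (norm ?z)\<^sup>2"
      by (simp add: inner_complex_def cmod_power2; algebra)
    moreover have "exp (- 2 * s) * ((norm ?a)\<^sup>2 * (norm ?z)\<^sup>2) = (norm ?a)\<^sup>2"
      by (simp add: norm_E flip: exp_double exp_add)
    ultimately show ?thesis by (simp add: area_density_def)
  qed
  have comp_cont: "continuous_on {(s, t). 0 < U (E s t)} (\<lambda>x. f (E (fst x) (snd x)))"
    if "continuous_on D f" for f :: "complex \<Rightarrow> complex"
    by (rule continuous_on_compose2[OF that E_cont]) (auto simp: Upos)
  show ?thesis
  proof
    show "continuous_on UNIV (\<lambda>(s, t). U (E s t))"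
      using continuous_on_compose2[OF U_cont E_cont] by (simp add: case_prod_unfold)
    show "0 \<le> U (E s t)" for s t using pos by (auto simp: U_def less_imp_le)
    show "continuous_on {(s, t). 0 < U (E s t)} (\<lambda>(s, t). ?n (E s t) \<bullet> E s t)"
      "continuous_on {(s, t). 0 < U (E s t)} (\<lambda>(s, t). ?n (E s t) \<bullet> (\<i> * E s t))"
      unfolding case_prod_unfold
      by (intro continuous_intros comp_cont[unfolded case_prod_unfold] n_cont E_cont)+
    have "continuous_on {(s, t). 0 < U (E s t)} (\<lambda>x. Re (E (fst x) (snd x)) *\<^sub>R ?DV (E (fst x) (snd x)) 1
        + Im (E (fst x) (snd x)) *\<^sub>R ?DV (E (fst x) (snd x)) \<i>)"
      using V_C1 by (intro continuous_intros E_cont comp_cont) (auto simp: C1_on_def Basis_complex_def)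
    then have "continuous_on {(s, t). 0 < U (E s t)} (\<lambda>x. ?DV (E (fst x) (snd x)) (E (fst x) (snd x)))"
      by (rule continuous_on_eq) (auto simp: Upos V'_lin[symmetric])
    then show "continuous_on {(s, t). 0 < U (E s t)}
        (\<lambda>(s, t). ?DV (E s t) (E s t) \<bullet> E s t + V (E s t) \<bullet> E s t)"
      unfolding case_prod_unfold
      by (intro continuous_on_add continuous_on_inner comp_cont[OF V_cont, unfolded case_prod_unfold] E_cont)
    show "((\<lambda>s. U (E s t)) has_real_derivative ?n (E s t) \<bullet> E s t) (at s)" if "0 < U (E s t)" for s t
      using vector_derivative_diff_chain_within[OF E_s has_derivative_at_withinI[OF u'], of s t] that
      by (simp add: Upos has_real_derivative_iff_has_vector_derivative o_def inner_commute)
    show "((\<lambda>t. U (E s t)) has_real_derivative ?n (E s t) \<bullet> (\<i> * E s t)) (at t)" if "0 < U (E s t)" for s t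
      using vector_derivative_diff_chain_within[OF E_t has_derivative_at_withinI[OF u'], of s t] that
      by (simp add: Upos has_real_derivative_iff_has_vector_derivative o_def inner_commute)
    have P: "(?n (E s t) \<bullet> x) / area_density (\<lambda>s t. ?n (E s t) \<bullet> E s t) (\<lambda>s t. ?n (E s t) \<bullet> (\<i> * E s t)) s t
        = V (E s t) \<bullet> x" for s t x
      by (simp add: W V_def inverse_eq_divide)
    show "((\<lambda>s. (?n (E s t) \<bullet> E s t) / area_density (\<lambda>s t. ?n (E s t) \<bullet> E s t) (\<lambda>s t. ?n (E s t) \<bullet> (\<i> * E s t)) s t)
        has_real_derivative ?DV (E s t) (E s t) \<bullet> E s t + V (E s t) \<bullet> E s t) (at s)"
      if "0 < U (E s t)" for s t
    proof -
      have "((\<lambda>s. V (E s t)) has_vector_derivative ?DV (E s t) (E s t)) (at s)"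
        using vector_derivative_diff_chain_within[OF E_s has_derivative_at_withinI[OF V'], of s t] that
        by (simp add: Upos o_def)
      from bounded_bilinear.has_vector_derivative[OF bounded_bilinear_inner this E_s]
      show ?thesis unfolding P by (simp add: has_real_derivative_iff_has_vector_derivative add.commute)
    qed
    show "((\<lambda>t. (?n (E s t) \<bullet> (\<i> * E s t)) / area_density (\<lambda>s t. ?n (E s t) \<bullet> E s t) (\<lambda>s t. ?n (E s t) \<bullet> (\<i> * E s t)) s t)
        has_real_derivative - (?DV (E s t) (E s t) \<bullet> E s t + V (E s t) \<bullet> E s t)) (at t)"
      if "0 < U (E s t)" for s t
    proof -
      have 1: "((\<lambda>t. V (E s t)) has_vector_derivative ?DV (E s t) (\<i> * E s t)) (at t)"
        using vector_derivative_diff_chain_within[OF E_t has_derivative_at_withinI[OF V'], of s t] that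
        by (simp add: Upos o_def)
      have 2: "((\<lambda>t. \<i> * E s t) has_vector_derivative - E s t) (at t)"
        using has_vector_derivative_mult_right[OF E_t, of \<i>] by (simp flip: mult.assoc)
      have "V (E s t) \<bullet> - E s t + ?DV (E s t) (\<i> * E s t) \<bullet> (\<i> * E s t)
          = - (?DV (E s t) (E s t) \<bullet> E s t + V (E s t) \<bullet> E s t)"
        using trace[of "E s t" "E s t"] that by (simp add: Upos)
      with bounded_bilinear.has_vector_derivative[OF bounded_bilinear_inner 1 2]
      show ?thesis unfolding P by (simp add: has_real_derivative_iff_has_vector_derivative)
    qed
    show "\<exists>K. \<forall>s\<le>0. \<forall>t. U (E s t) \<le> K"
    proof -
      have "compact (U ` cball 0 1)"
        by (intro compact_continuous_image continuous_on_subset[OF U_cont]) auto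
      then have "bounded (U ` cball 0 1)" by (rule compact_imp_bounded)
      then obtain K where K: "\<And>x. x \<in> cball 0 1 \<Longrightarrow> norm (U x) \<le> K"
        unfolding bounded_iff by blast
      have "U (E s t) \<le> K" if "s \<le> 0" for s t
      proof -
        have "E s t \<in> cball 0 1" using that by (simp add: norm_E)
        from K[OF this] show ?thesis by simp
      qed
      then show ?thesis by blast
    qed
  qed (simp_all add: per)
qed

subsection \<open>The growth theorem\<close>

text \<open>The circle winds once about \<open>z0\<close>, whereas a closed path in a simply
  connected set has winding number 0 about every outside point.\<close>

lemma circle_not_subset_simply_connected:
  fixes D :: "complex set"
  assumes "simply_connected D" and "z0 \<notin> D" and "cmod z0 < r"
  obtains z where "cmod z = r" and "z \<notin> D"
proof (rule ccontr)
  assume "\<not> thesis"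
  then have "sphere 0 r \<subseteq> D" using that by (meson mem_sphere_0 subsetI)
  moreover have "0 < r" using assms(3) by (meson le_less_trans norm_ge_zero)
  ultimately have "winding_number (circlepath 0 r) z0 = 0"
    using assms by (intro simply_connected_imp_winding_number_zero[of D]) auto
  moreover have "winding_number (circlepath 0 r) z0 = 1"
    using assms(3) by (intro winding_number_circlepath) simp
  ultimately show False by simp
qed

text \<open>The intermediate value theorem for \<open>cmod\<close> on \<open>D\<close>.\<close>

lemma circle_meets_unbounded_connected:
  fixes D :: "complex set"
  assumes "connected D" and "\<not> bounded D" and "z1 \<in> D" and "cmod z1 \<le> r"
  obtains z where "cmod z = r" and "z \<in> D"
proof -
  obtain z2 where z2: "z2 \<in> D" "r < cmod z2"
    using assms(2) by (meson bounded_iff not_le)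
  have "connected (cmod ` D)"
    using assms(1) by (intro connected_continuous_image continuous_intros)
  then have "r \<in> cmod ` D"
    using connectedD_interval[of "cmod ` D" "cmod z1" "cmod z2" r] assms(3,4) z2 by auto
  with that show ?thesis by auto
qed

text \<open>The extension by 0 attains its maximum on the compact circle. This maximum is positive,
  hence attained in \<open>D\<close>, so \<open>circle_max\<close> is a genuine maximum.\<close>

lemma circle_max_bound:
  fixes D :: "complex set"
  assumes cont: "continuous_on UNIV (\<lambda>z. if z \<in> D then u z else 0)" (is "continuous_on _ ?U")
    and pos: "\<And>z. z \<in> D \<Longrightarrow> u z > 0"
    and z: "z \<in> D" "cmod z = r"
  shows "0 < circle_max D u r" and "\<And>w. cmod w = r \<Longrightarrow> ?U w \<le> circle_max D u r"
proof -
  have "z \<in> sphere 0 r" using z by simp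
  then have "sphere (0::complex) r \<noteq> {}" by blast
  then obtain m where m: "m \<in> sphere 0 r" and max: "\<And>w. w \<in> sphere 0 r \<Longrightarrow> ?U w \<le> ?U m"
    using continuous_attains_sup[OF compact_sphere _ continuous_on_subset[OF cont subset_UNIV]] by metis
  have "0 < ?U m" using max[of z] z pos[of z] by auto
  then have mD: "m \<in> D" by (auto split: if_splits)
  have "circle_max D u r = u m"
    unfolding circle_max_def
  proof (rule Greatest_equality)
    show "u m \<in> u ` (D \<inter> {z. cmod z = r})" using m mD by auto
    show "y \<le> u m" if y: "y \<in> u ` (D \<inter> {z. cmod z = r})" for y
    proof -
      obtain w where "w \<in> D" "cmod w = r" "y = u w" using y by blast
      then show ?thesis using max[of w] mD by simp
    qed
  qed
  then show "0 < circle_max D u r" and "\<And>w. cmod w = r \<Longrightarrow> ?U w \<le> circle_max D u r"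
    using max \<open>0 < ?U m\<close> mD by auto
qed

theorem theorem1:
  fixes D :: "complex set" and u :: "complex \<Rightarrow> real"
  assumes "open D" and "connected D" and "D \<noteq> {}"
    and "\<not> bounded D" and "simply_connected D" and "frontier D \<noteq> {}"
    and "C2_on D u" and "continuous_on (closure D) u"
    and "minimal_surface_eq_on D u"
    and "\<And>z. z \<in> D \<Longrightarrow> u z > 0"
    and "\<And>z. z \<in> frontier D \<Longrightarrow> u z = 0"
  shows "Liminf at_top (\<lambda>r::real. ereal (ln (circle_max D u r) / ln r)) \<ge> ereal (1/2)"
proof -
  note pos = assms(10)
  define U where "U = (\<lambda>z. if z \<in> D then u z else 0)"
  define E where "E = (\<lambda>s t. exp (Complex s t))"
  \<comment> \<open>Pasting over the closed sets \<open>closure D\<close> and \<open>- D\<close>; on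
    the frontier both prescriptions give 0.\<close>
  have U_cont: "continuous_on UNIV U"
  proof -
    have "continuous_on (closure D) U"
      by (rule continuous_on_eq[OF assms(8)])
        (use assms(1,11) in \<open>auto simp: U_def frontier_def interior_open\<close>)
    moreover have "continuous_on (- D) U"
      by (rule continuous_on_eq[OF continuous_on_const[of _ 0]]) (auto simp: U_def)
    ultimately have "continuous_on (closure D \<union> - D) U"
      using \<open>open D\<close> by (intro continuous_on_closed_Un) auto
    moreover have "closure D \<union> - D = UNIV" using closure_subset by auto
    ultimately show ?thesis by simp
  qed
  interpret log_minimal_graph "\<lambda>s t. U (E s t)"
    "\<lambda>s t. gradient u (E s t) \<bullet> E s t" "\<lambda>s t. gradient u (E s t) \<bullet> (\<i> * E s t)"
    "\<lambda>s t. frechet_derivative (\<lambda>z. gradient u z /\<^sub>R sqrt (1 + (norm (gradient u z))\<^sup>2)) (at (E s t)) (E s t) \<bullet> E s t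
      + (gradient u (E s t) /\<^sub>R sqrt (1 + (norm (gradient u (E s t)))\<^sup>2)) \<bullet> E s t"
    using minimal_graph_log_coordinates[OF assms(1,7) U_cont[unfolded U_def] assms(9) pos]
    by (simp add: U_def E_def)
  have norm_E: "cmod (E s t) = exp s" for s t by (simp add: E_def)
  have E_polar: "\<exists>t. E (ln (cmod z)) t = z" if "z \<noteq> 0" for z
  proof
    have "Complex (ln (cmod z)) (Im (Ln z)) = Ln z"
      using that by (simp add: complex_eq_iff)
    then show "E (ln (cmod z)) (Im (Ln z)) = z" using that by (simp add: E_def)
  qed
  \<comment> \<open>The origin is avoided because \<open>exp\<close> omits it.\<close>
  obtain z1 where z1: "z1 \<in> D" "z1 \<noteq> 0"
  proof -
    have "infinite D" using assms(4) finite_imp_bounded by blast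
    then have "\<not> D \<subseteq> {0}" using finite_subset by blast
    then show ?thesis using that by blast
  qed
  obtain z0 where "z0 \<in> frontier D" using assms(6) by blast
  then have z0: "z0 \<notin> D" using assms(1) by (simp add: frontier_def interior_open)
  obtain t1 where t1: "E (ln (cmod z1)) t1 = z1" using E_polar z1 by blast
  have v_pos: "0 < U (E (ln (cmod z1)) t1)" using z1 pos by (simp add: t1 U_def)
  \<comment> \<open>Adding 1 makes the radius strictly larger than \<open>cmod z0\<close> and the
    argument of the logarithm positive.\<close>
  have v_zero: "\<exists>t. U (E s t) = 0" if "ln (cmod z0 + 1) \<le> s" for s
  proof -
    have "exp (ln (cmod z0 + 1)) \<le> exp s" using that by simp
    then have "cmod z0 + 1 \<le> exp s" by (simp add: add_nonneg_pos)
    then obtain z where z: "cmod z = exp s" "z \<notin> D"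
      using circle_not_subset_simply_connected[OF assms(5) z0, of "exp s"] by auto
    then have "z \<noteq> 0" by auto
    from E_polar[OF this] z show ?thesis by (auto simp: U_def)
  qed
  obtain c S0 where c: "0 < c"
    and growth: "\<And>S \<mu>. S0 \<le> S \<Longrightarrow> 0 < \<mu> \<Longrightarrow> (\<And>t. U (E S t) \<le> \<mu>) \<Longrightarrow> c * exp (S / 2) \<le> \<mu>"
    using sup_growth[OF v_pos v_zero] by blast
  \<comment> \<open>For \<open>r \<ge> R\<close> one has \<open>ln r > 0\<close>, the circle of
    radius \<open>r\<close> meets \<open>D\<close>, and \<open>ln r \<ge> S0\<close>.\<close>
  define R where "R = max 2 (max (cmod z1) (exp S0))"
  have lower: "1 / 2 + ln c / ln r \<le> ln (circle_max D u r) / ln r" if r: "R \<le> r" for r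
  proof -
    have r2: "2 \<le> r" "cmod z1 \<le> r" "exp S0 \<le> r" using r by (auto simp: R_def)
    obtain z where z: "cmod z = r" "z \<in> D"
      using circle_meets_unbounded_connected[OF assms(2,4) z1(1) r2(2)] by blast
    note M = circle_max_bound[OF U_cont[unfolded U_def] pos z(2,1), folded U_def]
    have "S0 \<le> ln r" using r2 by (simp add: ln_ge_iff)
    moreover have "U (E (ln r) t) \<le> circle_max D u r" for t
      using M(2)[of "E (ln r) t"] r2 by (simp add: norm_E U_def)
    ultimately have le: "c * exp (ln r / 2) \<le> circle_max D u r"
      using growth M(1) by blast
    have "ln c + ln r / 2 = ln (c * exp (ln r / 2))" using c by (simp add: ln_mult)
    also have "\<dots> \<le> ln (circle_max D u r)"
      using le c M(1) by (subst ln_le_cancel_iff) auto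
    finally have "(ln c + ln r / 2) / ln r \<le> ln (circle_max D u r) / ln r"
      using r2 by (intro divide_right_mono) auto
    then show ?thesis
      using r2 by (simp add: add_divide_distrib add.commute)
  qed
  have "((\<lambda>r. 1 / 2 + ln c / ln r) \<longlongrightarrow> 1 / 2 + 0) at_top"
    by (intro tendsto_add tendsto_const tendsto_divide_0[OF tendsto_const]
        filterlim_at_top_imp_at_infinity ln_at_top)
  then have "((\<lambda>r. ereal (1 / 2 + ln c / ln r)) \<longlongrightarrow> ereal (1 / 2)) at_top"
    by simp
  then have "Liminf at_top (\<lambda>r. ereal (1 / 2 + ln c / ln r)) = ereal (1 / 2)"
    by (intro lim_imp_Liminf) auto
  moreover have "Liminf at_top (\<lambda>r. ereal (1 / 2 + ln c / ln r))
      \<le> Liminf at_top (\<lambda>r. ereal (ln (circle_max D u r) / ln r))"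
    using lower by (intro Liminf_mono) (auto simp: eventually_at_top_linorder)
  ultimately show ?thesis by simp
qed

end
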